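(* Let $r\geq 2$ be an integer, let $c=r^{-(r+7)(r+1)}/2$, let $0<\alpha<r^{-8}/8$, let $n\geq e^{2/c}$ be an integer, and let $G$ be a graph of order $n$ with exactly $\lceil (1-1/r-\alpha)n^2/2\rceil$ edges. Then at least one of the following holds: (i) $G$ contains a (not necessarily induced) subgraph isomorphic to $K_r^+\left(\lfloor c\ln n\rfloor,\ldots,\lfloor c\ln n\rfloor\right)$, with all $r$ parts of size $\lfloor c\ln n\rfloor$; (ii) $G$ contains an induced subgraph $G_0$ which is $r$-partite (i.e. $r$-colorable), has order at least $(1-\sqrt{2\alpha})n$, and has minimum degree $\delta(G_0)>(1-1/r-2\sqrt{2\alpha})n$.
   Context: For integers $s_1\geq 2,s_2,\ldots,s_r\geq 1$, $K_r^+(s_1,\ldots,s_r)$ denotes the complete $r$-partite graph with parts of sizes $s_1,\ldots,s_r$ together with one additional edge joining two vertices of the first part (the part of size $s_1$). $\delta(H)$ denotes the minimum degree of a graph $H$. *)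

theory Defs
  imports Complex_Main
begin

record 'a graph =
  verts :: "'a set"
  edges :: "'a set set"

definition simple_graph :: "'a graph \<Rightarrow> bool" where
  "simple_graph G \<longleftrightarrow> finite (verts G) \<and> (\<forall>e\<in>edges G. e \<subseteq> verts G \<and> card e = 2)"

definition graph_order :: "'a graph \<Rightarrow> nat" where
  "graph_order G = card (verts G)"

definition graph_size :: "'a graph \<Rightarrow> nat" where
  "graph_size G = card (edges G)"

definition vertex_degree :: "'a graph \<Rightarrow> 'a \<Rightarrow> nat" where
  "vertex_degree G v = card {e \<in> edges G. v \<in> e}"

text \<open>Only meaningful for graphs with at least one vertex.\<close>
definition min_degree :: "'a graph \<Rightarrow> nat" where
  "min_degree G = Min (vertex_degree G ` verts G)"

definition subgraph :: "'a graph \<Rightarrow> 'a graph \<Rightarrow> bool" where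
  "subgraph H G \<longleftrightarrow> simple_graph H \<and> verts H \<subseteq> verts G \<and> edges H \<subseteq> edges G"

definition induced_subgraph :: "'a graph \<Rightarrow> 'a graph \<Rightarrow> bool" where
  "induced_subgraph H G \<longleftrightarrow>
     verts H \<subseteq> verts G \<and> edges H = {e \<in> edges G. e \<subseteq> verts H}"

definition isomorphic :: "'a graph \<Rightarrow> 'b graph \<Rightarrow> bool" where
  "isomorphic G H \<longleftrightarrow>
     (\<exists>f. bij_betw f (verts G) (verts H) \<and>
          (\<forall>u\<in>verts G. \<forall>v\<in>verts G. {u, v} \<in> edges G \<longleftrightarrow> {f u, f v} \<in> edges H))"

text \<open>Vertex classes are allowed to be empty, so this is \<open>r\<close>-colourability.\<close>
definition partite :: "nat \<Rightarrow> 'a graph \<Rightarrow> bool" where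
  "partite r G \<longleftrightarrow>
     (\<exists>f. f ` verts G \<subseteq> {..<r} \<and>
          (\<forall>u v. {u, v} \<in> edges G \<longrightarrow> f u \<noteq> f v))"

text \<open>
  The list holds the part sizes; its length is the number \<open>r\<close> of parts. The vertex \<open>(i, a)\<close> is
  the \<open>a\<close>-th vertex of part \<open>i\<close>, both counted from \<open>0\<close>.
\<close>
definition complete_multipartite :: "nat list \<Rightarrow> (nat \<times> nat) graph" where
  "complete_multipartite s =
     \<lparr>verts = {(i, a). i < length s \<and> a < s ! i},
      edges = {{(i, a), (j, b)} | i a j b.
                 i < length s \<and> a < s ! i \<and> j < length s \<and> b < s ! j \<and> i \<noteq> j}\<rparr>"

text \<open>
  The graph \<open>K\<^sub>r\<^sup>+(s\<^sub>1, \<dots>, s\<^sub>r)\<close>, for \<open>s\<^sub>1 \<ge> 2\<close>. By symmetry the choice of the two vertices of the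
  first part that are joined is immaterial.
\<close>
definition K_plus :: "nat list \<Rightarrow> (nat \<times> nat) graph" where
  "K_plus s =
     (complete_multipartite s)
       \<lparr>edges := insert {(0, 0), (0, 1)} (edges (complete_multipartite s))\<rparr>"

lemma simple_graph_complete_multipartite: "simple_graph (complete_multipartite s)"
proof -
  have "{(i, a). i < length s \<and> a < s ! i} = (SIGMA i:{..<length s}. {..<s ! i})"
    by auto
  then have "finite {(i, a). i < length s \<and> a < s ! i}"
    by simp
  then show ?thesis
    by (auto simp: simple_graph_def complete_multipartite_def card_insert_if)
qed

lemma simple_graph_K_plus:
  assumes "s \<noteq> []" "hd s \<ge> 2"
  shows "simple_graph (K_plus s)"
proof -
  have "s ! 0 \<ge> 2"
    using assms by (simp add: hd_conv_nth)
  then have "{(0, 0), (0, 1)} \<subseteq> verts (complete_multipartite s)"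
    using assms by (auto simp: complete_multipartite_def)
  then show ?thesis
    using simple_graph_complete_multipartite[of s] by (auto simp: simple_graph_def K_plus_def)
qed

end

theory Submission imports Defs begin

text \<open>
  Write \<open>\<epsilon> = sqrt (2 \<alpha>)\<close> and \<open>\<eta> = 1 / r\<^sup>4\<close>. An induced subgraph on \<open>m\<close> vertices, \<open>m\<close> a constant
  fraction of \<open>n\<close>, whose minimum degree exceeds \<open>(1 - 1 / r - \<eta>) m\<close>, is \<open>r\<close>-colourable if it has no
  \<open>(r + 1)\<close>-clique (an Andrasfai-Erdos-Sos argument). If it has one, averaging over the pairs in the
  clique gives an edge \<open>u v\<close> whose common neighbourhood \<open>W\<close> is so large that any \<open>r - 2\<close> vertices still
  have at least \<open>\<eta> m\<close> common neighbours in \<open>W\<close>. Hence \<open>r - 1\<close> parts can be embedded into \<open>W\<close> and one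
  more part anywhere, each step costing a constant factor in the part size; putting \<open>u\<close> and \<open>v\<close> into
  the last part gives \<open>K\<^sub>r\<^sup>+\<close>.

  To reach such a subgraph, delete up to \<open>\<epsilon> n\<close> vertices of degree at most \<open>(1 - 1 / r - 2 \<epsilon>) n\<close>. Either
  this stops early, which gives \<open>G\<^sub>0\<close>, or a subgraph with more edges than the Turan bound remains.
  The latter has a large subgraph of minimum degree above \<open>(1 - 1 / r - \<eta>) m\<close> that still exceeds the
  Turan bound and so is not \<open>r\<close>-colourable.
\<close>

section \<open>Adjacency relations and greedily chosen cliques\<close>

text \<open>Over a fixed adjacency relation an induced subgraph is just its vertex set, so passing
  to subgraphs needs no graph records.\<close>

locale symmetric_irreflexive =
  fixes adj :: "'a \<Rightarrow> 'a \<Rightarrow> bool"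
  assumes adj_sym: "adj x y \<Longrightarrow> adj y x"
    and adj_irrefl: "\<not> adj x x"
begin

definition nbrs :: "'a set \<Rightarrow> 'a \<Rightarrow> 'a set" where
  "nbrs S v = {w \<in> S. adj v w}"

text \<open>Twice the number of edges inside \<open>S\<close>; in this scale the Turan bound is
  \<open>(1 - 1 / r) |S|\<^sup>2\<close>.\<close>

definition degree_sum :: "'a set \<Rightarrow> nat" where
  "degree_sum S = (\<Sum>v\<in>S. card (nbrs S v))"

text \<open>A clique as an indexed family. Distinctness of the vertices need not be demanded, since
  adjacency is irreflexive.\<close>

definition clique_map :: "nat set \<Rightarrow> (nat \<Rightarrow> 'a) \<Rightarrow> bool" where
  "clique_map I y \<longleftrightarrow> (\<forall>i\<in>I. \<forall>j\<in>I. i \<noteq> j \<longrightarrow> adj (y i) (y j))"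

definition colourable :: "nat \<Rightarrow> 'a set \<Rightarrow> bool" where
  "colourable r S \<longleftrightarrow> (\<exists>f. f ` S \<subseteq> {..<r} \<and> (\<forall>u\<in>S. \<forall>v\<in>S. adj u v \<longrightarrow> f u \<noteq> f v))"

lemma nbrs_subset: "nbrs S v \<subseteq> S"
  by (auto simp: nbrs_def)

lemma finite_nbrs: "finite S \<Longrightarrow> finite (nbrs S v)"
  by (rule finite_subset[OF nbrs_subset])

lemma clique_map_upd:
  assumes "clique_map I y" "\<And>i. i \<in> I \<Longrightarrow> i \<noteq> a \<Longrightarrow> adj x (y i)"
  shows "clique_map (insert a I) (y(a := x))"
  using assms by (auto simp: clique_map_def intro: adj_sym)

text \<open>Greedy choice: the vertices chosen so far exclude at most the sum of their
  \<open>d j\<close> from the next set, which is larger than that. The bound \<open>d j\<close> is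
  tied to the set that the excluding vertex comes from, so each class can later carry its own
  defect.\<close>

lemma transversal_clique:
  fixes d :: "nat \<Rightarrow> real"
  assumes "finite I"
    and "\<And>i. i \<in> I \<Longrightarrow> finite (U i)"
    and "\<And>i j z. i \<in> I \<Longrightarrow> j \<in> I \<Longrightarrow> i \<noteq> j \<Longrightarrow> z \<in> U j \<Longrightarrow> real (card {w \<in> U i. \<not> adj z w}) \<le> d j"
    and "\<And>i. i \<in> I \<Longrightarrow> 0 \<le> d i"
    and "\<And>i. i \<in> I \<Longrightarrow> (\<Sum>j\<in>I - {i}. d j) < real (card (U i))"
  shows "\<exists>y. (\<forall>i\<in>I. y i \<in> U i) \<and> clique_map I y"
  using assms
proof (induction I rule: finite_induct)
  case empty
  then show ?case by (simp add: clique_map_def)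
next
  case (insert a I)
  have "(\<Sum>j\<in>I - {i}. d j) < real (card (U i))" if "i \<in> I" for i
  proof -
    have "(\<Sum>j\<in>I - {i}. d j) \<le> (\<Sum>j\<in>insert a I - {i}. d j)"
      using insert by (intro sum_mono2) auto
    then show ?thesis using insert.prems(4)[of i] that by simp
  qed
  then have "\<exists>y. (\<forall>i\<in>I. y i \<in> U i) \<and> clique_map I y"
    using insert.prems by (intro insert.IH) simp_all
  then obtain y where y: "\<forall>i\<in>I. y i \<in> U i" "clique_map I y"
    by blast
  let ?B = "\<Union>j\<in>I. {w \<in> U a. \<not> adj (y j) w}"
  have "real (card ?B) \<le> real (\<Sum>j\<in>I. card {w \<in> U a. \<not> adj (y j) w})"
    using card_UN_le[OF insert.hyps(1)] of_nat_le_iff by blast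
  also have "\<dots> \<le> (\<Sum>j\<in>I. d j)"
    unfolding of_nat_sum using y insert.hyps by (intro sum_mono insert.prems(2)) auto
  also have "\<dots> < real (card (U a))"
    using insert.prems(4)[of a] insert.hyps by simp
  finally have "card ?B < card (U a)" by simp
  moreover have "finite ?B" using insert by auto
  ultimately have "\<not> U a \<subseteq> ?B"
    using card_mono[of ?B "U a"] by linarith
  then obtain x where "x \<in> U a" "x \<notin> ?B"
    by blast
  then have x: "x \<in> U a" "\<And>i. i \<in> I \<Longrightarrow> adj x (y i)"
    by (auto intro: adj_sym)
  then have "clique_map (insert a I) (y(a := x))"
    using y(2) by (intro clique_map_upd) auto
  moreover have "\<forall>i\<in>insert a I. (y(a := x)) i \<in> U i"
    using x y(1) insert.hyps by simp
  ultimately show ?case by blast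
qed

text \<open>Every edge at \<open>v\<close> is counted at both of its ends, hence the factor 2. This
  is what turns extremality of a functional of \<open>degree_sum\<close> into a minimum
  degree.\<close>

lemma degree_sum_delete:
  assumes "finite S" "v \<in> S"
  shows "degree_sum S = degree_sum (S - {v}) + 2 * card (nbrs S v)"
proof -
  have *: "card (nbrs S x) = card (nbrs (S - {v}) x) + (if adj v x then 1 else 0)" if "x \<in> S - {v}" for x
  proof (cases "adj v x")
    case True
    then have "nbrs S x = insert v (nbrs (S - {v}) x)"
      using assms by (auto simp: nbrs_def intro: adj_sym)
    then show ?thesis
      using assms True by (simp add: finite_nbrs) (simp add: nbrs_def)
  next
    case False
    then have "nbrs S x = nbrs (S - {v}) x"
      using adj_sym[of x v] by (auto simp: nbrs_def)
    then show ?thesis using False by simp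
  qed
  have "degree_sum S = card (nbrs S v) + (\<Sum>x\<in>S - {v}. card (nbrs S x))"
    unfolding degree_sum_def using assms by (simp add: sum.remove)
  also have "(\<Sum>x\<in>S - {v}. card (nbrs S x)) = degree_sum (S - {v}) + (\<Sum>x\<in>S - {v}. if adj v x then 1 else 0)"
    unfolding degree_sum_def by (simp add: * sum.distrib)
  also have "(\<Sum>x\<in>S - {v}. if adj v x then 1 else 0 :: nat) = card {x \<in> S - {v}. adj v x}"
    using assms by (simp add: sum.If_cases Int_def)
  also have "{x \<in> S - {v}. adj v x} = nbrs S v"
    using adj_irrefl by (auto simp: nbrs_def)
  finally show ?thesis by simp
qed

section \<open>Cliques and colourings under a minimum degree condition\<close>

text \<open>
  The number \<open>d w\<close> of neighbours of \<open>w\<close> in the clique averages above \<open>r - 1\<close>, and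
  \<open>(d - r) (d - r + 1) \<ge> 0\<close> for integral \<open>d\<close> bounds the sum of \<open>d (d - 1)\<close>, which counts the common
  neighbours of all pairs in the clique.
\<close>
lemma rich_edge:
  fixes r :: nat and \<eta> :: real
  assumes "finite S" "r \<ge> 2" and \<eta>: "\<eta> = 1 / real r ^ 4"
    and deg: "\<And>v. v \<in> S \<Longrightarrow> real (card (nbrs S v)) > (1 - 1 / real r - \<eta>) * real (card S)"
    and y: "\<And>i. i \<le> r \<Longrightarrow> y i \<in> S" "clique_map {..r} y"
  shows "\<exists>u\<in>S. \<exists>v\<in>S. adj u v \<and>
    real (card (nbrs S u \<inter> nbrs S v)) \<ge> ((real r - 2) * (1 / real r + \<eta>) + \<eta>) * real (card S)"
proof (rule ccontr)
  assume neg: "\<not> ?thesis"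
  define m where "m = real (card S)"
  define X where "X = (real r - 2) * (1 / real r + \<eta>) + \<eta>"
  define d where "d w = card {i \<in> {..r}. adj w (y i)}" for w
  have r: "real r \<ge> 2" using assms by simp
  have m: "m > 0"
    using y(1)[of 0] assms(1) by (auto simp: m_def card_gt_0_iff)
  have small: "real (card (nbrs S (y i) \<inter> nbrs S (y j))) \<le> X * m" if "i \<le> r" "j \<le> r" "i \<noteq> j" for i j
  proof -
    have "adj (y i) (y j)" using y(2) that by (simp add: clique_map_def)
    then have "\<not> X * m \<le> real (card (nbrs S (y i) \<inter> nbrs S (y j)))"
      using neg y(1)[OF that(1)] y(1)[OF that(2)] unfolding X_def m_def by blast
    then show ?thesis by simp
  qed
  have sd: "(\<Sum>w\<in>S. d w) = (\<Sum>i\<in>{..r}. card (nbrs S (y i)))"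
  proof -
    have "(\<Sum>w\<in>S. d w) = (\<Sum>w\<in>S. \<Sum>i\<in>{..r}. if adj w (y i) then 1 else 0)"
      unfolding d_def by (intro sum.cong refl) (simp add: sum.If_cases Int_def)
    also have "\<dots> = (\<Sum>i\<in>{..r}. \<Sum>w\<in>S. if adj w (y i) then 1 else 0)"
      by (rule sum.swap)
    also have "\<dots> = (\<Sum>i\<in>{..r}. card (nbrs S (y i)))"
      using assms(1) by (intro sum.cong refl) (auto simp: sum.If_cases nbrs_def Int_def intro!: arg_cong[where f=card] intro: adj_sym)
    finally show ?thesis .
  qed
  have sdd: "(\<Sum>w\<in>S. d w * d w) = (\<Sum>i\<in>{..r}. \<Sum>j\<in>{..r}. card (nbrs S (y i) \<inter> nbrs S (y j)))"
  proof -
    have "(\<Sum>w\<in>S. d w * d w) = (\<Sum>w\<in>S. \<Sum>i\<in>{..r}. \<Sum>j\<in>{..r}. (if adj w (y i) then 1 else 0) * (if adj w (y j) then 1 else 0))"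
    proof (intro sum.cong refl)
      fix w
      have "d w = (\<Sum>i\<in>{..r}. if adj w (y i) then 1 else 0)"
        unfolding d_def by (simp add: sum.If_cases Int_def)
      then show "d w * d w = (\<Sum>i\<in>{..r}. \<Sum>j\<in>{..r}. (if adj w (y i) then 1 else 0) * (if adj w (y j) then 1 else 0))"
        by (simp only: sum_product)
    qed
    also have "\<dots> = (\<Sum>i\<in>{..r}. \<Sum>w\<in>S. \<Sum>j\<in>{..r}. (if adj w (y i) then 1 else 0) * (if adj w (y j) then 1 else 0))"
      by (rule sum.swap)
    also have "\<dots> = (\<Sum>i\<in>{..r}. \<Sum>j\<in>{..r}. \<Sum>w\<in>S. (if adj w (y i) then 1 else 0) * (if adj w (y j) then 1 else 0))"
      by (intro sum.cong refl sum.swap)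
    also have "\<dots> = (\<Sum>i\<in>{..r}. \<Sum>j\<in>{..r}. card (nbrs S (y i) \<inter> nbrs S (y j)))"
    proof (intro sum.cong refl)
      fix i j
      have "(\<Sum>w\<in>S. (if adj w (y i) then 1 else 0) * (if adj w (y j) then 1 else 0 :: nat))
          = (\<Sum>w\<in>S. if adj w (y i) \<and> adj w (y j) then 1 else 0)"
        by (intro sum.cong refl) simp
      also have "\<dots> = card (nbrs S (y i) \<inter> nbrs S (y j))"
        using assms(1) by (auto simp: sum.If_cases nbrs_def Int_def intro!: arg_cong[where f=card] intro: adj_sym)
      finally show "(\<Sum>w\<in>S. (if adj w (y i) then 1 else 0) * (if adj w (y j) then 1 else 0)) = card (nbrs S (y i) \<inter> nbrs S (y j))" .
    qed
    finally show ?thesis .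
  qed
  \<comment> \<open>For fixed \<open>i\<close> the diagonal term is the degree of
    \<open>y i\<close>; the \<open>r\<close> others are codegrees of clique edges, bounded by
    \<open>small\<close>.\<close>
  have "(\<Sum>i\<in>{..r}. \<Sum>j\<in>{..r}. real (card (nbrs S (y i) \<inter> nbrs S (y j))))
     \<le> (\<Sum>i\<in>{..r}. real (card (nbrs S (y i))) + r * (X * m))"
  proof (intro sum_mono)
    fix i assume i: "i \<in> {..r}"
    have "(\<Sum>j\<in>{..r}. real (card (nbrs S (y i) \<inter> nbrs S (y j))))
       = real (card (nbrs S (y i))) + (\<Sum>j\<in>{..r} - {i}. real (card (nbrs S (y i) \<inter> nbrs S (y j))))"
      using i by (simp add: sum.remove)
    also have "(\<Sum>j\<in>{..r} - {i}. real (card (nbrs S (y i) \<inter> nbrs S (y j)))) \<le> (\<Sum>j\<in>{..r} - {i}. X * m)"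
      using i by (intro sum_mono small) auto
    also have "\<dots> = r * (X * m)" using i by simp
    finally show "(\<Sum>j\<in>{..r}. real (card (nbrs S (y i) \<inter> nbrs S (y j)))) \<le> real (card (nbrs S (y i))) + r * (X * m)"
      by simp
  qed
  then have up: "(\<Sum>w\<in>S. real (d w) * real (d w)) \<le> (\<Sum>w\<in>S. real (d w)) + (real r + 1) * (r * (X * m))"
    using arg_cong[OF sdd, of real] arg_cong[OF sd, of real] by (simp add: sum.distrib algebra_simps)
  have "real (d w) * real (d w) - real (d w) \<ge> 2 * (real r - 1) * real (d w) - real r * (real r - 1)" for w
  proof -
    have "(int (d w) - int r) * (int (d w) - int r + 1) \<ge> 0"
      by (cases "int (d w) \<ge> int r") (auto intro: mult_nonneg_nonneg mult_nonpos_nonpos)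
    then have "real_of_int ((int (d w) - int r) * (int (d w) - int r + 1)) \<ge> 0"
      by linarith
    then show ?thesis by (simp add: algebra_simps)
  qed
  then have "(\<Sum>w\<in>S. 2 * (real r - 1) * real (d w) - real r * (real r - 1)) \<le> (\<Sum>w\<in>S. real (d w) * real (d w) - real (d w))"
    by (intro sum_mono)
  then have low: "2 * (real r - 1) * (\<Sum>w\<in>S. real (d w)) - real r * (real r - 1) * m \<le> (real r + 1) * (r * (X * m))"
    using up by (simp add: sum_subtractf m_def flip: sum_distrib_left) (simp add: algebra_simps)
  have "(\<Sum>i\<in>{..r}. (1 - 1 / real r - \<eta>) * m) < (\<Sum>i\<in>{..r}. real (card (nbrs S (y i))))"
    using deg y by (intro sum_strict_mono) (auto simp: m_def)
  then have "(real r + 1) * ((1 - 1 / real r - \<eta>) * m) < (\<Sum>w\<in>S. real (d w))"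
    using arg_cong[OF sd, of real] by (simp add: add.commute)
  then have "2 * (real r - 1) * ((real r + 1) * ((1 - 1 / real r - \<eta>) * m)) < 2 * (real r - 1) * (\<Sum>w\<in>S. real (d w))"
    using r by (intro mult_strict_left_mono) auto
  then have "2 * (real r - 1) * ((real r + 1) * ((1 - 1 / real r - \<eta>) * m)) - real r * (real r - 1) * m < (real r + 1) * (r * (X * m))"
    using low by linarith
  then have "(2 * (real r - 1) * (real r + 1) * (1 - 1 / real r - \<eta>) - real r * (real r - 1)) * m < ((real r + 1) * r * X) * m"
    by (simp only: left_diff_distrib mult.assoc)
  then have "2 * (real r - 1) * (real r + 1) * (1 - 1 / real r - \<eta>) - real r * (real r - 1) < (real r + 1) * r * X"
    using m by simp
  then have "r * (2 * (real r - 1) * (real r + 1) * (1 - 1 / real r - \<eta>) - real r * (real r - 1)) < r * ((real r + 1) * r * X)"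
    using r by (intro mult_strict_left_mono) auto
  moreover have "r * (2 * (real r - 1) * (real r + 1) * (1 - 1 / real r - \<eta>) - real r * (real r - 1)) =
      2 * (real r - 1) * (real r + 1) * (real r - 1 - real r * \<eta>) - (real r)^2 * (real r - 1)"
    using r by (simp add: field_simps power2_eq_square)
  moreover have "r * ((real r + 1) * r * X) = (real r + 1) * r * ((real r - 2) * (1 + r * \<eta>) + r * \<eta>)"
    using r by (simp add: X_def field_simps)
  ultimately have "2 * (real r - 1) * (real r + 1) * (real r - 1 - real r * \<eta>) - (real r)^2 * (real r - 1)
      < (real r + 1) * r * ((real r - 2) * (1 + r * \<eta>) + r * \<eta>)"
    by (simp only:)
  \<comment> \<open>The terms free of \<open>\<eta>\<close> cancel except for 2. The choice
    \<open>\<eta> = 1 / r ^ 4\<close> refutes the rest, because the product on the right is below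
    \<open>2 r ^ 4\<close>.\<close>
  then have "2 < \<eta> * ((real r ^ 2 - 1) * (real r ^ 2 + 2 * r))"
    by (simp add: algebra_simps power2_eq_square)
  then have "2 * real r ^ 4 < (real r ^ 2 - 1) * (real r ^ 2 + 2 * r)"
    using r by (simp add: \<eta> field_simps)
  moreover have "(real r ^ 2 - 1) * (real r ^ 2 + 2 * r) = 2 * real r ^ 4 - (real r * (real r - 1)) ^ 2 - 2 * real r"
    by (simp add: algebra_simps power2_eq_square power4_eq_xxxx)
  moreover have "(real r * (real r - 1)) ^ 2 \<ge> 0" by simp
  ultimately show False using r by linarith
qed

text \<open>
  An \<open>r\<close>-clique \<open>v\<close> defines independent sets \<open>A i\<close>, the common neighbourhoods of the \<open>v j\<close> with \<open>j \<noteq> i\<close>.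
  They cover almost everything, so each is almost completely joined to the others, up to the defect
  \<open>d i\<close>; every vertex then misses some \<open>A i\<close> entirely and takes \<open>i\<close> as its colour.
\<close>
lemma colourable_if_clique_free:
  fixes r :: nat and \<eta> :: real
  assumes fin: "finite S" and r2: "r \<ge> 2" and \<eta>: "\<eta> = 1 / real r ^ 4"
    and deg: "\<And>v. v \<in> S \<Longrightarrow> real (card (nbrs S v)) > (1 - 1 / real r - \<eta>) * real (card S)"
    and free: "\<And>y. (\<And>i. i \<le> r \<Longrightarrow> y i \<in> S) \<Longrightarrow> \<not> clique_map {..r} y"
  shows "colourable r S"
proof (cases "S = {}")
  case True
  then show ?thesis by (simp add: colourable_def)
next
  case False
  define m where "m = real (card S)"
  \<comment> \<open>\<open>\<beta> m\<close> bounds the number of non-neighbours of a vertex, itself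
    included. \<open>\<beta>2\<close> leaves room for a greedy \<open>r\<close>-clique, and
    \<open>\<beta>1\<close> keeps the total defect \<open>D\<close> below half of
    \<open>\<beta> m\<close>.\<close>
  define \<beta> where "\<beta> = 1 / real r + \<eta>"
  have r: "real r \<ge> 2" using r2 by simp
  have m: "m > 0" using False fin by (simp add: m_def card_gt_0_iff)
  have \<eta>0: "\<eta> > 0" using r by (simp add: \<eta>)
  have \<beta>0: "\<beta> > 0" using r \<eta>0 by (simp add: \<beta>_def add_pos_pos)
  have \<beta>1: "4 * real r * \<eta> < \<beta>"
  proof -
    have "real r * (real r * real r) \<ge> real r * (2 * 2)"
      using r by (intro mult_left_mono mult_mono) auto
    then have "4 * real r < real r ^ 3 + 1" by (simp add: power3_eq_cube)
    then show ?thesis using r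
      by (simp add: \<beta>_def \<eta> field_simps power4_eq_xxxx power3_eq_cube)
  qed
  have \<beta>2: "(real r - 1) * \<beta> < 1"
  proof -
    have "real r ^ 3 \<ge> real r ^ 1" using r by (intro power_increasing) auto
    then have "real r - 1 < real r ^ 3" unfolding power_one_right by linarith
    then show ?thesis using r
      by (simp add: \<beta>_def \<eta> field_simps power4_eq_xxxx power3_eq_cube)
  qed
  have r\<beta>: "real r * \<beta> = 1 + real r * \<eta>"
    using r by (simp add: \<beta>_def field_simps)
  have deg': "real (card (nbrs S v)) > m - \<beta> * m" if "v \<in> S" for v
    using deg[OF that] by (simp add: m_def \<beta>_def algebra_simps)
  have nonnbr: "real (card {w \<in> S. \<not> adj z w}) < \<beta> * m" if "z \<in> S" for z
  proof -
    have "card S = card (nbrs S z) + card {w \<in> S. \<not> adj z w}"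
      unfolding nbrs_def using fin by (subst card_Un_disjoint[symmetric]) (auto intro: arg_cong[where f=card])
    then show ?thesis using deg'[OF that] by (simp add: m_def)
  qed
  have "\<exists>v. (\<forall>i\<in>{..<r}. v i \<in> S) \<and> clique_map {..<r} v"
  proof (rule transversal_clique[where d = "\<lambda>_. \<beta> * m"])
    fix i assume "i \<in> {..<r}"
    then have "(\<Sum>j\<in>{..<r} - {i}. \<beta> * m) = ((real r - 1) * \<beta>) * m"
      using r2 by (simp add: of_nat_diff)
    also have "\<dots> < 1 * m" using \<beta>2 m by (intro mult_strict_right_mono) auto
    finally show "(\<Sum>j\<in>{..<r} - {i}. \<beta> * m) < real (card S)" by (simp add: m_def)
  qed (use fin nonnbr \<beta>0 m in \<open>auto intro: less_imp_le\<close>)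
  then obtain v where v: "\<And>i. i < r \<Longrightarrow> v i \<in> S" "clique_map {..<r} v" by auto
  have no_clique: False if "\<And>i. i < r \<Longrightarrow> y i \<in> S" "clique_map {..<r} y" "x \<in> S" "\<And>i. i < r \<Longrightarrow> adj x (y i)" for y x
  proof -
    have "clique_map (insert r {..<r}) (y(r := x))"
      using that by (intro clique_map_upd) auto
    moreover have "insert r {..<r} = {..r}" by auto
    ultimately show False using free[of "y(r := x)"] that by (auto simp: le_less)
  qed
  have no_clique2: False
    if "i < r" "\<And>j. j < r \<Longrightarrow> j \<noteq> i \<Longrightarrow> y j \<in> S" "clique_map ({..<r} - {i}) y" "x \<in> S" "x' \<in> S" "adj x x'"
      "\<And>j. j < r \<Longrightarrow> j \<noteq> i \<Longrightarrow> adj x (y j)" "\<And>j. j < r \<Longrightarrow> j \<noteq> i \<Longrightarrow> adj x' (y j)" for i y x x'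
  proof (rule no_clique[of "y(i := x)" x'])
    have "clique_map (insert i ({..<r} - {i})) (y(i := x))"
      using that by (intro clique_map_upd) auto
    then show "clique_map {..<r} (y(i := x))"
      using that(1) by (simp add: insert_absorb)
  qed (use that in \<open>auto intro: adj_sym\<close>)
  define A where "A i = {w \<in> S. \<forall>j<r. j \<noteq> i \<longrightarrow> adj w (v j)}" for i
  have AS: "A i \<subseteq> S" for i by (auto simp: A_def)
  have finA: "finite (A i)" for i using AS fin by (rule finite_subset)
  have vA: "v i \<in> A i" if "i < r" for i
    using v that by (auto simp: A_def clique_map_def)
  have indep: "\<not> adj x x'" if "i < r" "x \<in> A i" "x' \<in> A i" for i x x'
    using no_clique2[of i v x x'] that v by (auto simp: A_def clique_map_def)
  have disj: "A i \<inter> A j = {}" if "i < r" "j < r" "i \<noteq> j" for i j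
  proof (rule ccontr)
    assume "A i \<inter> A j \<noteq> {}"
    then obtain w where w: "w \<in> A i" "w \<in> A j" by blast
    then have "adj w (v l)" if "l < r" for l
      using that \<open>i \<noteq> j\<close> by (cases "l = i") (auto simp: A_def)
    then show False using no_clique[of v w] v w AS by blast
  qed
  define X where "X = S - (\<Union>i<r. A i)"
  \<comment> \<open>Double counting bounds \<open>X\<close>: every vertex misses some
    \<open>v i\<close>, as there is no \<open>(r + 1)\<close>-clique, and a vertex of
    \<open>X\<close> misses two, since a single miss at \<open>v i\<close> would put it into
    \<open>A i\<close>.\<close>
  define h where "h w = card {j \<in> {..<r}. adj w (v j)}" for w
  have "(\<Sum>w\<in>S. h w) = (\<Sum>w\<in>S. \<Sum>i\<in>{..<r}. if adj w (v i) then 1 else 0)"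
    unfolding h_def by (intro sum.cong refl) (simp add: sum.If_cases Int_def)
  also have "\<dots> = (\<Sum>i\<in>{..<r}. \<Sum>w\<in>S. if adj w (v i) then 1 else 0)"
    by (rule sum.swap)
  also have "\<dots> = (\<Sum>i\<in>{..<r}. card (nbrs S (v i)))"
    using fin by (intro sum.cong refl) (auto simp: sum.If_cases nbrs_def Int_def intro!: arg_cong[where f=card] intro: adj_sym)
  finally have "real (\<Sum>w\<in>S. h w) = (\<Sum>i\<in>{..<r}. real (card (nbrs S (v i))))" by simp
  also have "\<dots> \<ge> (\<Sum>i\<in>{..<r}. m - \<beta> * m)"
    using deg' v by (intro sum_mono) (auto intro: less_imp_le)
  finally have h_low: "real r * (m - \<beta> * m) \<le> (\<Sum>w\<in>S. real (h w))" by simp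
  have "(\<Sum>w\<in>S. real (h w)) \<le> (\<Sum>w\<in>S. (real r - 1) - (if w \<in> X then 1 else 0))"
  proof (intro sum_mono)
    fix w assume w: "w \<in> S"
    have sub: "{j \<in> {..<r}. adj w (v j)} \<subseteq> {..<r}" by auto
    have "{j \<in> {..<r}. adj w (v j)} \<noteq> {..<r}"
      using no_clique[of v w] v w by blast
    with sub obtain i where i: "i < r" "\<not> adj w (v i)" by blast
    show "real (h w) \<le> (real r - 1) - (if w \<in> X then 1 else 0)"
    proof (cases "w \<in> X")
      case True
      then have "w \<notin> A i" using i by (auto simp: X_def)
      then obtain j where j: "j < r" "j \<noteq> i" "\<not> adj w (v j)" using w by (auto simp: A_def)
      have "h w \<le> card ({..<r} - {i, j})"
        unfolding h_def using i j by (intro card_mono) auto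
      also have "\<dots> = r - 2" using i j by (subst card_Diff_subset) auto
      finally show ?thesis using True r2 by (simp add: of_nat_diff)
    next
      case False
      have "h w \<le> card ({..<r} - {i})"
        unfolding h_def using i by (intro card_mono) auto
      then show ?thesis using False r2 i by (simp add: of_nat_diff)
    qed
  qed
  also have "\<dots> = (real r - 1) * m - real (card X)"
  proof -
    have "S \<inter> X = X" by (auto simp: X_def)
    then show ?thesis using fin by (simp only: sum_subtractf) (simp add: sum.If_cases m_def algebra_simps)
  qed
  finally have "real r * (m - \<beta> * m) \<le> (real r - 1) * m - real (card X)"
    using h_low by linarith
  moreover have "real r * (m - \<beta> * m) = real r * m - (real r * \<beta>) * m" by (simp add: algebra_simps)
  ultimately have "real r * m - (1 + real r * \<eta>) * m \<le> (real r - 1) * m - real (card X)"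
    by (simp only: r\<beta>)
  then have X: "real (card X) \<le> real r * \<eta> * m"
    by (simp add: algebra_simps)
  \<comment> \<open>A vertex without neighbours in \<open>A i\<close> has spent \<open>|A i|\<close>
    of its fewer than \<open>\<beta> m\<close> non-neighbours there; less than \<open>d i\<close>
    remain outside. The total \<open>D\<close> is \<open>r \<eta> m + |X|\<close>.\<close>
  define d where "d i = \<beta> * m - real (card (A i))" for i
  define D where "D = (\<Sum>i<r. d i)"
  have "card S = card X + (\<Sum>i<r. card (A i))"
  proof -
    have "S = X \<union> (\<Union>i<r. A i)" using AS by (auto simp: X_def)
    then have "card S = card X + card (\<Union>i<r. A i)"
      using card_Un_disjoint[of X "\<Union>i<r. A i"] fin finA by (auto simp: X_def)
    also have "card (\<Union>i<r. A i) = (\<Sum>i<r. card (A i))"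
      using finA disj by (intro card_UN_disjoint) auto
    finally show ?thesis .
  qed
  then have "D = real r * \<beta> * m - m + real (card X)"
    by (simp add: D_def d_def sum_subtractf m_def)
  then have "D = (1 + real r * \<eta>) * m - m + real (card X)" by (simp only: r\<beta>)
  then have D: "D \<le> 2 * real r * \<eta> * m" using X by (simp add: algebra_simps)
  have D\<beta>: "2 * D < \<beta> * m"
  proof -
    have "2 * D \<le> (4 * real r * \<eta>) * m" using D by linarith
    also have "\<dots> < \<beta> * m" using \<beta>1 m by (intro mult_strict_right_mono)
    finally show ?thesis .
  qed
  have out: "real (card {w \<in> S - A i. \<not> adj z w}) < d i" if "i < r" "z \<in> S" "nbrs S z \<inter> A i = {}" for i z
  proof -
    have "card {w \<in> S. \<not> adj z w} = card (A i) + card {w \<in> S - A i. \<not> adj z w}"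
    proof -
      have "{w \<in> S. \<not> adj z w} = A i \<union> {w \<in> S - A i. \<not> adj z w}"
        using that AS[of i] by (auto simp: nbrs_def)
      then show ?thesis using finA fin by (simp add: card_Un_disjoint Int_def)
    qed
    then show ?thesis using nonnbr[OF that(2)] by (simp add: d_def)
  qed
  have outA: "real (card {w \<in> S - A i. \<not> adj z w}) < d i" if "i < r" "z \<in> A i" for i z
    using that indep AS[of i] by (intro out) (auto simp: nbrs_def)
  have d0: "d i > 0" if "i < r" for i
    using outA[OF that vA[OF that]] by simp
  have outB: "real (card {w \<in> B. \<not> adj z w}) \<le> d i" if "i < r" "z \<in> A i" "B \<subseteq> S" "B \<inter> A i = {}" for i z B
  proof -
    have "card {w \<in> B. \<not> adj z w} \<le> card {w \<in> S - A i. \<not> adj z w}"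
      using that fin by (intro card_mono) auto
    then show ?thesis using outA[OF that(1,2)] by linarith
  qed
  have free_class: "\<exists>i<r. nbrs S y \<inter> A i = {}" if y: "y \<in> S" for y
  proof (rule ccontr)
    assume neg: "\<not> ?thesis"
    \<comment> \<open>At most one class is exceptional: each such class holds at least
      \<open>|A i| - (D - d i) = \<beta> m - D\<close> non-neighbours of \<open>y\<close>, and two
      of them would give \<open>2 \<beta> m - 2 D > \<beta> m\<close>.\<close>
    have "\<exists>a<r. \<forall>i<r. i \<noteq> a \<longrightarrow> real (card (nbrs S y \<inter> A i)) > D - d i"
    proof (rule ccontr)
      assume no: "\<not> ?thesis"
      obtain a where a: "a < r" "real (card (nbrs S y \<inter> A a)) \<le> D - d a"
        using no r2 by (metis not_less order_less_le_trans pos2)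
      obtain b where b: "b < r" "b \<noteq> a" "real (card (nbrs S y \<inter> A b)) \<le> D - d b"
        using no a(1) by (meson not_less)
      have split: "card (A i) = card (nbrs S y \<inter> A i) + card {w \<in> A i. \<not> adj y w}" for i
      proof -
        have "A i = (nbrs S y \<inter> A i) \<union> {w \<in> A i. \<not> adj y w}"
          using AS[of i] by (auto simp: nbrs_def)
        moreover have "(nbrs S y \<inter> A i) \<inter> {w \<in> A i. \<not> adj y w} = {}" by (auto simp: nbrs_def)
        ultimately show ?thesis
          using card_Un_disjoint[of "nbrs S y \<inter> A i" "{w \<in> A i. \<not> adj y w}"] finA by simp
      qed
      have "card {w \<in> A a. \<not> adj y w} + card {w \<in> A b. \<not> adj y w} = card ({w \<in> A a. \<not> adj y w} \<union> {w \<in> A b. \<not> adj y w})"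
        using finA disj[of a b] a b by (subst card_Un_disjoint) auto
      also have "\<dots> \<le> card {w \<in> S. \<not> adj y w}"
        using fin AS[of a] AS[of b] by (intro card_mono) auto
      finally have "real (card (A a)) + real (card (A b)) - (D - d a) - (D - d b) < \<beta> * m"
        using nonnbr[OF y] split[of a] split[of b] a(2) b(3) by linarith
      then show False using D\<beta> by (simp add: d_def)
    qed
    then obtain a where a: "a < r" "\<And>i. i < r \<Longrightarrow> i \<noteq> a \<Longrightarrow> real (card (nbrs S y \<inter> A i)) > D - d i" by blast
    \<comment> \<open>In the exceptional class a single neighbour \<open>z\<close> of
      \<open>y\<close> is enough: the other classes still contain an \<open>(r - 1)\<close>-clique
      joined to both \<open>y\<close> and \<open>z\<close>.\<close>
    obtain z where z: "z \<in> nbrs S y \<inter> A a" using neg a(1) by blast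
    define U where "U i = {w \<in> nbrs S y \<inter> A i. adj z w}" for i
    have "\<exists>x. (\<forall>i\<in>{..<r} - {a}. x i \<in> U i) \<and> clique_map ({..<r} - {a}) x"
    proof (rule transversal_clique[where d = d])
      fix i j w assume ij: "i \<in> {..<r} - {a}" "j \<in> {..<r} - {a}" "i \<noteq> j" "w \<in> U j"
      then show "real (card {x \<in> U i. \<not> adj w x}) \<le> d j"
        using AS[of i] disj[of i j] by (intro outB) (auto simp: U_def)
    next
      fix i assume i: "i \<in> {..<r} - {a}"
      have "real (card {w \<in> nbrs S y \<inter> A i. \<not> adj z w}) \<le> d a"
        using AS[of i] disj[of i a] a i z by (intro outB) auto
      moreover have "card (nbrs S y \<inter> A i) = card (U i) + card {w \<in> nbrs S y \<inter> A i. \<not> adj z w}"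
        unfolding U_def using finA by (subst card_Un_disjoint[symmetric]) (auto intro: arg_cong[where f=card])
      ultimately have "real (card (U i)) > D - d i - d a"
        using a(2)[of i] i by simp
      moreover have "D = d a + (d i + sum d ({..<r} - {a} - {i}))"
      proof -
        have "D = d a + sum d ({..<r} - {a})" unfolding D_def using a(1) by (simp add: sum.remove)
        then show ?thesis using i by (simp add: sum.remove[of "{..<r} - {a}" i])
      qed
      ultimately show "sum d ({..<r} - {a} - {i}) < real (card (U i))" by simp
    qed (use finA d0 in \<open>auto simp: U_def intro: less_imp_le\<close>)
    then obtain x where "\<forall>i\<in>{..<r} - {a}. x i \<in> U i" "clique_map ({..<r} - {a}) x" by blast
    then show False
      using no_clique2[of a x z y] a(1) z y by (auto simp: U_def nbrs_def intro: adj_sym)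
  qed
  obtain f where f: "\<And>y. y \<in> S \<Longrightarrow> f y < r \<and> nbrs S y \<inter> A (f y) = {}"
    using free_class by metis
  have "f y \<noteq> f y'" if y: "y \<in> S" "y' \<in> S" "adj y y'" for y y'
  proof
    assume eq: "f y = f y'"
    define i where "i = f y"
    have i: "i < r" "nbrs S y \<inter> A i = {}" "nbrs S y' \<inter> A i = {}"
      using f[OF y(1)] f[OF y(2)] eq by (auto simp: i_def)
    \<comment> \<open>Both ends of the edge avoid \<open>A i\<close>, so each has fewer than
      \<open>d i\<close> non-neighbours in the other classes. Their common neighbours there contain
      an \<open>(r - 1)\<close>-clique, which the edge completes to an
      \<open>(r + 1)\<close>-clique.\<close>
    define U where "U j = {w \<in> A j. adj y w \<and> adj y' w}" for j
    have "\<exists>x. (\<forall>j\<in>{..<r} - {i}. x j \<in> U j) \<and> clique_map ({..<r} - {i}) x"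
    proof (rule transversal_clique[where d = d])
      fix l j w assume lj: "l \<in> {..<r} - {i}" "j \<in> {..<r} - {i}" "l \<noteq> j" "w \<in> U j"
      then show "real (card {x \<in> U l. \<not> adj w x}) \<le> d j"
        using AS[of l] disj[of l j] by (intro outB) (auto simp: U_def)
    next
      fix j assume j: "j \<in> {..<r} - {i}"
      have sub: "{w \<in> A j. \<not> adj z w} \<subseteq> {w \<in> S - A i. \<not> adj z w}" for z
        using AS[of j] disj[of i j] i(1) j by auto
      have "A j \<subseteq> U j \<union> ({w \<in> A j. \<not> adj y w} \<union> {w \<in> A j. \<not> adj y' w})" by (auto simp: U_def)
      then have "card (A j) \<le> card (U j \<union> ({w \<in> A j. \<not> adj y w} \<union> {w \<in> A j. \<not> adj y' w}))"
        using finA by (intro card_mono) (auto simp: U_def)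
      also have "\<dots> \<le> card (U j) + (card {w \<in> A j. \<not> adj y w} + card {w \<in> A j. \<not> adj y' w})"
        by (intro order_trans[OF card_Un_le] add_left_mono card_Un_le)
      also have "\<dots> \<le> card (U j) + (card {w \<in> S - A i. \<not> adj y w} + card {w \<in> S - A i. \<not> adj y' w})"
        using sub fin by (intro add_left_mono add_mono card_mono) auto
      finally have "real (card (A j)) < real (card (U j)) + 2 * d i"
        using out[OF i(1) y(1) i(2)] out[OF i(1) y(2) i(3)] by linarith
      moreover have "D = d i + (d j + sum d ({..<r} - {i} - {j}))"
      proof -
        have "D = d i + sum d ({..<r} - {i})" unfolding D_def using i(1) by (simp add: sum.remove)
        then show ?thesis using j by (simp add: sum.remove[of "{..<r} - {i}" j])
      qed
      moreover have "d i \<le> D"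
        unfolding D_def using i(1) d0 by (intro member_le_sum) (auto intro: less_imp_le)
      ultimately show "sum d ({..<r} - {i} - {j}) < real (card (U j))"
        using D\<beta> d_def[of j] by linarith
    qed (use finA d0 in \<open>auto simp: U_def intro: less_imp_le\<close>)
    then obtain x where "\<forall>j\<in>{..<r} - {i}. x j \<in> U j" "clique_map ({..<r} - {i}) x" by blast
    then show False
      using no_clique2[of i x y y'] i(1) y subsetD[OF AS] by (auto simp: U_def)
  qed
  then show ?thesis
    using f unfolding colourable_def by (intro exI[of _ f]) auto
qed

section \<open>Embedding complete multipartite graphs\<close>

text \<open>
  The \<open>j\<close>-th vertices of the parts form a row. A new part is chosen by pigeonhole among the vertices
  \<open>w\<close> that extend many rows, according to the set \<open>I w\<close> of rows extended; only these rows survive.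
\<close>
lemma complete_multipartite_embedding:
  fixes \<kappa> :: real and T r :: nat
  assumes fin: "finite S" and \<kappa>: "0 < \<kappa>" and T: "T > 0" "real T * 2 ^ Suc T \<le> \<kappa> * real (card S)"
    and US: "\<And>k. k < r \<Longrightarrow> U k \<subseteq> S"
    and ext: "\<And>k Q. k < r \<Longrightarrow> finite Q \<Longrightarrow> Q \<subseteq> S \<Longrightarrow> card Q \<le> k \<Longrightarrow>
      real (card {w \<in> U k. \<forall>q\<in>Q. adj w q}) \<ge> \<kappa> * real (card S)"
  shows "k \<le> r \<Longrightarrow> \<exists>J x. J \<subseteq> {..<T} \<and> (\<kappa> / 2) ^ k * real T \<le> real (card J)
    \<and> (\<forall>i<k. \<forall>j\<in>J. x i j \<in> U i) \<and> (\<forall>i<k. inj_on (x i) J)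
    \<and> (\<forall>i<k. \<forall>i'<k. i \<noteq> i' \<longrightarrow> (\<forall>j\<in>J. \<forall>j'\<in>J. adj (x i j) (x i' j')))"
proof (induction k)
  case 0
  show ?case by (intro exI[of _ "{..<T}"]) simp
next
  case (Suc k)
  then have "k \<le> r" by simp
  from Suc.IH[OF this] obtain J x where J: "J \<subseteq> {..<T}" "(\<kappa> / 2) ^ k * real T \<le> real (card J)"
    and x: "\<forall>i<k. \<forall>j\<in>J. x i j \<in> U i" "\<forall>i<k. inj_on (x i) J"
      "\<forall>i<k. \<forall>i'<k. i \<noteq> i' \<longrightarrow> (\<forall>j\<in>J. \<forall>j'\<in>J. adj (x i j) (x i' j'))"
    by blast
  have kr: "k < r" using Suc.prems by simp
  define m where "m = real (card S)"
  have finJ: "finite J" using J(1) finite_subset by blast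
  have cardJ: "card J \<le> T" using card_mono[OF _ J(1)] by simp
  have "(\<kappa> / 2) ^ k * real T > 0" using \<kappa> T by simp
  then have J0: "real (card J) > 0" using J(2) by linarith
  define N where "N j = {w \<in> U k. \<forall>i<k. adj w (x i j)}" for j
  have NS: "N j \<subseteq> S" for j using US[OF kr] by (auto simp: N_def)
  have N: "real (card (N j)) \<ge> \<kappa> * m" if j: "j \<in> J" for j
  proof -
    have "x i j \<in> S" if "i < k" for i
      using x(1) US[of i] that j kr by auto
    then have "(\<lambda>i. x i j) ` {..<k} \<subseteq> S" by auto
    moreover have "card ((\<lambda>i. x i j) ` {..<k}) \<le> k"
      using card_image_le[of "{..<k}" "\<lambda>i. x i j"] by simp
    moreover have "N j = {w \<in> U k. \<forall>q\<in>(\<lambda>i. x i j) ` {..<k}. adj w q}" by (auto simp: N_def)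
    ultimately show ?thesis using ext[OF kr, of "(\<lambda>i. x i j) ` {..<k}"] by (simp add: m_def)
  qed
  define I where "I w = {j \<in> J. w \<in> N j}" for w
  define B where "B = {w \<in> S. real (card (I w)) \<ge> \<kappa> / 2 * real (card J)}"
  have finB: "finite B" using fin by (simp add: B_def)
  have I_sub: "I w \<in> Pow J" for w by (auto simp: I_def)
  have "(\<Sum>w\<in>S. card (I w)) = (\<Sum>w\<in>S. \<Sum>j\<in>J. if w \<in> N j then 1 else 0)"
    unfolding I_def using finJ by (intro sum.cong refl) (simp add: sum.If_cases Int_def)
  also have "\<dots> = (\<Sum>j\<in>J. \<Sum>w\<in>S. if w \<in> N j then 1 else 0)" by (rule sum.swap)
  also have "\<dots> = (\<Sum>j\<in>J. card (N j))"
    using fin NS by (intro sum.cong refl) (simp add: sum.If_cases Int_absorb1)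
  finally have "real (\<Sum>w\<in>S. card (I w)) = (\<Sum>j\<in>J. real (card (N j)))" by simp
  also have "\<dots> \<ge> (\<Sum>j\<in>J. \<kappa> * m)" using N by (intro sum_mono)
  finally have low: "real (card J) * (\<kappa> * m) \<le> (\<Sum>w\<in>S. real (card (I w)))" by simp
  have "(\<Sum>w\<in>S. real (card (I w))) \<le> (\<Sum>w\<in>S. \<kappa> / 2 * real (card J) + (if w \<in> B then real (card J) else 0))"
  proof (intro sum_mono)
    fix w assume "w \<in> S"
    have "card (I w) \<le> card J" using I_sub finJ by (intro card_mono) auto
    then show "real (card (I w)) \<le> \<kappa> / 2 * real (card J) + (if w \<in> B then real (card J) else 0)"
      using mult_pos_pos[OF \<kappa> J0] \<open>w \<in> S\<close> by (auto simp: B_def not_le)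
  qed
  also have "\<dots> = m * (\<kappa> / 2 * real (card J)) + real (card B) * real (card J)"
  proof -
    have "S \<inter> B = B" by (auto simp: B_def)
    then show ?thesis using fin by (simp add: sum.distrib sum.If_cases m_def)
  qed
  finally have "real (card J) * (\<kappa> * m / 2) \<le> real (card J) * real (card B)"
    using low by (simp add: algebra_simps)
  then have B: "\<kappa> * m / 2 \<le> real (card B)" using J0 by simp
  \<comment> \<open>The hypothesis on \<open>T\<close> gives \<open>|B| \<ge> T * 2 ^ T\<close>,
    that is \<open>T\<close> vertices for each of the at most \<open>2 ^ T\<close> possible row
    sets. As \<open>card J \<le> T\<close>, this is enough to put a new vertex into every surviving
    row.\<close>
  have "\<exists>J'\<in>Pow J. T \<le> card {w \<in> B. I w = J'}"
  proof (rule ccontr)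
    assume neg: "\<not> ?thesis"
    have "B = (\<Union>J'\<in>Pow J. {w \<in> B. I w = J'})" using I_sub by auto
    then have "card B \<le> (\<Sum>J'\<in>Pow J. card {w \<in> B. I w = J'})"
      using card_UN_le[of "Pow J" "\<lambda>J'. {w \<in> B. I w = J'}"] finJ by simp
    also have "\<dots> < (\<Sum>J'\<in>Pow J. T)"
      using neg finJ by (intro sum_strict_mono) (auto simp: not_le)
    also have "\<dots> = 2 ^ card J * T" using finJ by (simp add: card_Pow)
    also have "\<dots> \<le> 2 ^ T * T" using cardJ by simp
    finally have "real (card B) < real (2 ^ T * T)" by (simp only: of_nat_less_iff)
    then show False using B T(2) by (simp add: m_def mult.commute)
  qed
  then obtain J' where J': "J' \<subseteq> J" "T \<le> card {w \<in> B. I w = J'}" by blast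
  have finJ': "finite J'" using J'(1) finJ finite_subset by blast
  have "{w \<in> B. I w = J'} \<noteq> {}" using J'(2) T(1) by fastforce
  then have "\<kappa> / 2 * real (card J) \<le> real (card J')" by (auto simp: B_def)
  moreover have "\<kappa> / 2 * ((\<kappa> / 2) ^ k * real T) \<le> \<kappa> / 2 * real (card J)"
    using J(2) \<kappa> by (intro mult_left_mono) auto
  ultimately have cardJ': "(\<kappa> / 2) ^ Suc k * real T \<le> real (card J')" by (simp add: mult.assoc)
  have "card J' \<le> card {w \<in> B. I w = J'}"
    using J' cardJ card_mono[OF finJ J'(1)] by linarith
  then obtain g where g: "inj_on g J'" "g ` J' \<subseteq> {w \<in> B. I w = J'}"
    using inj_on_iff_card_le[OF finJ', of "{w \<in> B. I w = J'}"] finB by auto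
  \<comment> \<open>All \<open>g j\<close> extend the same row set \<open>J'\<close>, hence each is
    joined to every surviving row and not only to its own.\<close>
  have gN: "g j \<in> N j'" if "j \<in> J'" "j' \<in> J'" for j j'
    using g(2) that by (auto simp: I_def)
  have gadj: "adj (g j) (x i j')" "adj (x i j') (g j)" if "i < k" "j \<in> J'" "j' \<in> J'" for i j j'
    using gN[OF that(2,3)] that(1) by (auto simp: N_def intro: adj_sym)
  have gU: "g j \<in> U k" if "j \<in> J'" for j
    using gN[OF that that] by (simp add: N_def)
  show ?case
  proof (intro exI conjI)
    show "J' \<subseteq> {..<T}" using J J' by blast
    show "(\<kappa> / 2) ^ Suc k * real T \<le> real (card J')" by (rule cardJ')
    show "\<forall>i<Suc k. \<forall>j\<in>J'. (x(k := g)) i j \<in> U i"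
      using x(1) gU J'(1) by (auto simp: less_Suc_eq)
    show "\<forall>i<Suc k. inj_on ((x(k := g)) i) J'"
      using x(2) g(1) J'(1) by (auto simp: less_Suc_eq intro: inj_on_subset)
    show "\<forall>i<Suc k. \<forall>i'<Suc k. i \<noteq> i' \<longrightarrow> (\<forall>j\<in>J'. \<forall>j'\<in>J'. adj ((x(k := g)) i j) ((x(k := g)) i' j'))"
      using x(3) gadj J'(1) by (auto simp: less_Suc_eq subset_iff)
  qed
qed

section \<open>Dense subsets of large minimum degree\<close>

lemma degree_sum_le: "finite S \<Longrightarrow> degree_sum S \<le> card S * card S"
  unfolding degree_sum_def
  using sum_bounded_above[of S "\<lambda>v. card (nbrs S v)" "card S"] by (simp add: card_mono nbrs_subset)

text \<open>
  Maximising \<open>degree_sum S' - b |S'|\<^sup>2\<close> with \<open>b\<close> slightly below \<open>1 - 1 / r\<close> replaces the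
  successive deletion of vertices of small degree.
\<close>
lemma dense_subset_min_degree:
  fixes r :: nat and \<eta> :: real
  assumes fin: "finite S" and r2: "r \<ge> 2" and \<eta>: "\<eta> = 1 / real r ^ 4"
    and dense: "(1 - 1 / real r) * (real (card S))\<^sup>2 < real (degree_sum S)"
    and large: "real r ^ 7 < real (card S)"
  obtains S' where "S' \<subseteq> S" "real (card S) \<le> real r ^ 3 * real (card S')"
    "(1 - 1 / real r) * (real (card S'))\<^sup>2 < real (degree_sum S')"
    "\<And>v. v \<in> S' \<Longrightarrow> (1 - 1 / real r - \<eta>) * real (card S') < real (card (nbrs S' v))"
proof -
  have r: "real r \<ge> 2" using r2 by simp
  have \<eta>0: "\<eta> > 0" using r by (simp add: \<eta>)
  have "\<eta> < 1" using r by (simp add: \<eta>)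
  have r1: "1 / real r \<le> 1 / 2" using r by (intro divide_left_mono) auto
  \<comment> \<open>The slack \<open>\<eta>\<close> is split in half. One half makes the maximum of
    \<open>\<Psi>\<close> at least quadratic in \<open>|S|\<close>, which forces \<open>S'\<close>
    to be large and above the Turan bound; the other absorbs the error of deleting one vertex, since
    \<open>\<eta> m > 1\<close>.\<close>
  define b where "b = 1 - 1 / real r - \<eta> / 2"
  have b: "b \<ge> 0" "b \<le> 1"
    using r1 \<eta>0 \<open>\<eta> < 1\<close> divide_nonneg_nonneg[of 1 "real r"] unfolding b_def by linarith+
  define \<Psi> where "\<Psi> X = real (degree_sum X) - b * (real (card X))\<^sup>2" for X
  obtain S' where S': "S' \<subseteq> S" "\<And>X. X \<subseteq> S \<Longrightarrow> \<Psi> X \<le> \<Psi> S'"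
  proof -
    have ne: "finite (\<Psi> ` Pow S)" "\<Psi> ` Pow S \<noteq> {}" using fin by auto
    obtain S' where "S' \<in> Pow S" "\<Psi> S' = Max (\<Psi> ` Pow S)"
      using Max_in[OF ne] by (metis imageE)
    then show ?thesis using that[of S'] Max_ge[OF ne(1)] by auto
  qed
  define m where "m = real (card S')"
  have finS': "finite S'" using S'(1) fin finite_subset by blast
  have \<Psi>S: "\<eta> / 2 * (real (card S))\<^sup>2 < \<Psi> S'"
    using S'(2)[of S] dense by (simp add: \<Psi>_def b_def algebra_simps)
  have "\<Psi> S' \<le> real (degree_sum S')" using b by (simp add: \<Psi>_def)
  also have "\<dots> \<le> m\<^sup>2"
    using degree_sum_le[OF finS'] unfolding m_def power2_eq_square by (simp flip: of_nat_mult)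
  finally have m2: "\<eta> / 2 * (real (card S))\<^sup>2 < m\<^sup>2" using \<Psi>S by simp
  \<comment> \<open>The admissible loss \<open>r ^ 3\<close> comes from
    \<open>\<eta> / 2 * (r ^ 3)\<^sup>2 = r\<^sup>2 / 2 \<ge> 1\<close>.\<close>
  have "1 \<le> \<eta> / 2 * (real r ^ 3)\<^sup>2"
  proof -
    have "\<eta> / 2 * (real r ^ 3)\<^sup>2 = real r * real r / 2"
      using r by (simp add: \<eta> power2_eq_square power4_eq_xxxx power3_eq_cube)
    moreover have "2 * 2 \<le> real r * real r" using r by (intro mult_mono) auto
    ultimately show ?thesis by simp
  qed
  then have "1 * (real (card S))\<^sup>2 \<le> \<eta> / 2 * (real r ^ 3)\<^sup>2 * (real (card S))\<^sup>2"
    by (intro mult_right_mono) auto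
  also have "\<dots> = (real r ^ 3)\<^sup>2 * (\<eta> / 2 * (real (card S))\<^sup>2)" by simp
  also have "\<dots> \<le> (real r ^ 3)\<^sup>2 * m\<^sup>2" using m2 by (intro mult_left_mono) auto
  finally have "(real (card S))\<^sup>2 \<le> (real r ^ 3 * m)\<^sup>2" by (simp add: power_mult_distrib)
  then have sz: "real (card S) \<le> real r ^ 3 * m"
    by (rule power2_le_imp_le) (simp add: m_def)
  have "real r ^ 3 * real r ^ 4 = real r ^ 7" by (simp flip: power_add)
  then have "real r ^ 3 * real r ^ 4 < real r ^ 3 * m"
    using sz large by linarith
  then have m4: "real r ^ 4 < m" by (rule mult_left_less_imp_less) simp
  show ?thesis
  proof (rule that[OF S'(1)])
    show "real (card S) \<le> real r ^ 3 * real (card S')" using sz by (simp add: m_def)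
    have "card S' \<le> card S" using S'(1) fin by (simp add: card_mono)
    then have "m\<^sup>2 \<le> (real (card S))\<^sup>2" by (simp add: m_def power_mono)
    then have "\<eta> / 2 * m\<^sup>2 \<le> \<eta> / 2 * (real (card S))\<^sup>2" using \<eta>0 by (intro mult_left_mono) auto
    then show "(1 - 1 / real r) * (real (card S'))\<^sup>2 < real (degree_sum S')"
      using \<Psi>S by (simp add: \<Psi>_def b_def m_def algebra_simps)
  next
    fix v assume v: "v \<in> S'"
    have "\<Psi> (S' - {v}) \<le> \<Psi> S'" using S' by (intro S'(2)) auto
    moreover have "real (card (S' - {v})) = m - 1"
      using card.remove[OF finS' v] by (simp add: m_def)
    ultimately have "b * (2 * m - 1) \<le> 2 * real (card (nbrs S' v))"
      using degree_sum_delete[OF finS' v] by (simp add: \<Psi>_def m_def power2_eq_square algebra_simps)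
    moreover have "1 < \<eta> * m" using m4 r by (simp add: \<eta> field_simps)
    ultimately show "(1 - 1 / real r - \<eta>) * real (card S') < real (card (nbrs S' v))"
      using b(2) by (simp add: b_def m_def[symmetric] algebra_simps)
  qed
qed

section \<open>Embedding \<open>K_plus\<close> around an edge\<close>

text \<open>A copy of \<open>K_plus (replicate r s)\<close> inside \<open>S\<close>. Injectivity is
  required within each part only; vertices of different parts are adjacent and so distinct.\<close>

definition K_plus_map :: "nat \<Rightarrow> nat \<Rightarrow> 'a set \<Rightarrow> (nat \<Rightarrow> nat \<Rightarrow> 'a) \<Rightarrow> bool" where
  "K_plus_map r s S y \<longleftrightarrow> (\<forall>i<r. \<forall>a<s. y i a \<in> S) \<and> (\<forall>i<r. inj_on (y i) {..<s})
    \<and> (\<forall>i<r. \<forall>j<r. i \<noteq> j \<longrightarrow> (\<forall>a<s. \<forall>b<s. adj (y i a) (y j b))) \<and> adj (y 0 0) (y 0 1)"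

text \<open>Each vertex already placed in a row rules out at most \<open>\<beta> m\<close>
  candidates. For the first \<open>r - 1\<close> parts, which have to lie in \<open>W\<close>, at
  most \<open>r - 2\<close> vertices precede and \<open>rich\<close> leaves \<open>\<eta> m\<close>
  candidates. The last part may lie anywhere in \<open>S\<close>, where
  \<open>(r - 1) \<beta> + \<eta> \<le> 1\<close> suffices; its vertices, after making room for
  \<open>u\<close> and \<open>v\<close>, form part 0 of the copy.\<close>

lemma K_plus_map_if_rich_edge:
  fixes r s T :: nat and \<eta> :: real
  assumes fin: "finite S" and r2: "r \<ge> 2" and \<eta>: "\<eta> = 1 / real r ^ 4"
    and deg: "\<And>v. v \<in> S \<Longrightarrow> real (card (nbrs S v)) > (1 - 1 / real r - \<eta>) * real (card S)"
    and uv: "u \<in> S" "v \<in> S" "adj u v"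
    and rich: "real (card (nbrs S u \<inter> nbrs S v)) \<ge> ((real r - 2) * (1 / real r + \<eta>) + \<eta>) * real (card S)"
    and s: "s \<ge> 2" and T: "real T * 2 ^ Suc T \<le> \<eta> * real (card S)" "real s \<le> (\<eta> / 2) ^ r * real T"
  shows "\<exists>y. K_plus_map r s S y"
proof -
  have r: "real r \<ge> 2" using r2 by simp
  have \<eta>0: "\<eta> > 0" using r by (simp add: \<eta>)
  define \<beta> where "\<beta> = 1 / real r + \<eta>"
  define m where "m = real (card S)"
  have \<beta>0: "\<beta> > 0" using r \<eta>0 by (simp add: \<beta>_def add_pos_pos)
  have m0: "m \<ge> 0" by (simp add: m_def)
  have T0: "T > 0" using T(2) s by (cases T) auto
  define W where "W = nbrs S u \<inter> nbrs S v"
  define U where "U k = (if k = r - 1 then S else W)" for k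
  have US: "U k \<subseteq> S" for k by (auto simp: U_def W_def nbrs_def)
  have nonnbr: "real (card {w \<in> S. \<not> adj z w}) \<le> \<beta> * m" if "z \<in> S" for z
  proof -
    have "card S = card (nbrs S z) + card {w \<in> S. \<not> adj z w}"
      unfolding nbrs_def using fin by (subst card_Un_disjoint[symmetric]) (auto intro: arg_cong[where f=card])
    then show ?thesis using deg[OF that] by (simp add: m_def \<beta>_def algebra_simps)
  qed
  have ext: "real (card {w \<in> U k. \<forall>q\<in>Q. adj w q}) \<ge> \<eta> * real (card S)"
    if k: "k < r" and Q: "finite Q" "Q \<subseteq> S" "card Q \<le> k" for k Q
  proof -
    have finU: "finite (U k)" using US fin finite_subset by blast
    have "U k \<subseteq> {w \<in> U k. \<forall>q\<in>Q. adj w q} \<union> (\<Union>q\<in>Q. {w \<in> S. \<not> adj q w})"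
      using US[of k] by (auto intro: adj_sym)
    then have "card (U k) \<le> card ({w \<in> U k. \<forall>q\<in>Q. adj w q} \<union> (\<Union>q\<in>Q. {w \<in> S. \<not> adj q w}))"
      using finU Q fin by (intro card_mono) auto
    also have "\<dots> \<le> card {w \<in> U k. \<forall>q\<in>Q. adj w q} + card (\<Union>q\<in>Q. {w \<in> S. \<not> adj q w})"
      by (rule card_Un_le)
    also have "card (\<Union>q\<in>Q. {w \<in> S. \<not> adj q w}) \<le> (\<Sum>q\<in>Q. card {w \<in> S. \<not> adj q w})"
      using Q(1) by (rule card_UN_le)
    finally have "real (card (U k)) \<le> real (card {w \<in> U k. \<forall>q\<in>Q. adj w q}) + (\<Sum>q\<in>Q. real (card {w \<in> S. \<not> adj q w}))"
      by (simp flip: of_nat_sum of_nat_add)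
    also have "(\<Sum>q\<in>Q. real (card {w \<in> S. \<not> adj q w})) \<le> (\<Sum>q\<in>Q. \<beta> * m)"
      using nonnbr Q(2) by (intro sum_mono) auto
    also have "\<dots> = real (card Q) * (\<beta> * m)" by simp
    also have "\<dots> \<le> real k * (\<beta> * m)" using Q(3) \<beta>0 m0 by (intro mult_right_mono) auto
    finally have *: "real (card (U k)) - real k * (\<beta> * m) \<le> real (card {w \<in> U k. \<forall>q\<in>Q. adj w q})" by simp
    have "\<eta> * m \<le> real (card (U k)) - real k * (\<beta> * m)"
    proof (cases "k = r - 1")
      case True
      have "real r ^ 2 * 1 \<le> real r ^ 2 * real r ^ 2" using r by (intro mult_left_mono) auto
      then have "real r * real r * \<eta> \<le> 1"
        using r by (simp add: \<eta> field_simps power2_eq_square power4_eq_xxxx)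
      then have "real r * \<eta> \<le> 1 / real r" using r by (simp add: field_simps)
      moreover have "(real r - 1) * \<beta> + \<eta> = 1 - 1 / real r + real r * \<eta>"
        using r by (simp add: \<beta>_def field_simps)
      ultimately have "(real r - 1) * \<beta> + \<eta> \<le> 1" by linarith
      then have "((real r - 1) * \<beta> + \<eta>) * m \<le> 1 * m" using m0 by (intro mult_right_mono)
      moreover have "real k = real r - 1" using True r2 by (simp add: of_nat_diff)
      ultimately show ?thesis using True by (simp add: U_def m_def algebra_simps)
    next
      case False
      then have "real k \<le> real r - 2" using k by linarith
      then have "real k * (\<beta> * m) \<le> (real r - 2) * (\<beta> * m)" using \<beta>0 m0 by (intro mult_right_mono) auto
      moreover have "(real r - 2) * (\<beta> * m) + \<eta> * m \<le> real (card W)"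
        using rich unfolding W_def \<beta>_def m_def by (simp only: distrib_right mult.assoc)
      ultimately show ?thesis using False by (simp add: U_def)
    qed
    then show ?thesis using * by (simp add: m_def)
  qed
  obtain J x where J: "J \<subseteq> {..<T}" "(\<eta> / 2) ^ r * real T \<le> real (card J)"
    and x: "\<forall>i<r. \<forall>j\<in>J. x i j \<in> U i" "\<forall>i<r. inj_on (x i) J"
      "\<forall>i<r. \<forall>i'<r. i \<noteq> i' \<longrightarrow> (\<forall>j\<in>J. \<forall>j'\<in>J. adj (x i j) (x i' j'))"
    using complete_multipartite_embedding[of S \<eta> T r U r, OF fin \<eta>0 T0 T(1) US ext order_refl] by blast
  have finJ: "finite J" using J(1) finite_subset by blast
  have "s \<le> card J" using J(2) T(2) by linarith
  then obtain e where e: "inj_on e {..<s}" "e ` {..<s} \<subseteq> J"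
    using inj_on_iff_card_le[of "{..<s}" J] finJ by auto
  have eJ: "e a \<in> J" if "a < s" for a using e(2) that by auto
  define P where "P = (\<lambda>a. x (r - 1) (e a)) ` {..<s}"
  have inj: "inj_on (\<lambda>a. x i (e a)) {..<s}" if "i < r" for i
    using comp_inj_on[OF e(1) inj_on_subset[OF _ e(2)], of "x i"] x(2) that by (simp add: comp_def)
  have "inj_on (\<lambda>a. x (r - 1) (e a)) {..<s}"
    using inj[of "r - 1"] r2 by simp
  then have "card P = s" unfolding P_def by (simp add: card_image)
  \<comment> \<open>\<open>u\<close> and \<open>v\<close> may already occur in \<open>P\<close>.
    Removing them leaves at least \<open>s - 2\<close> vertices, exactly as many as are wanted
    besides \<open>u\<close> and \<open>v\<close>.\<close>
  then have "s - 2 \<le> card (P - {u, v})"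
    using diff_card_le_card_Diff[of "{u, v}" P] card_insert_le_m1[of 2 "{v}" u] by simp
  then obtain h where h: "inj_on h {..<s - 2}" "h ` {..<s - 2} \<subseteq> P - {u, v}"
    using inj_on_iff_card_le[of "{..<s - 2}" "P - {u, v}"] by (auto simp: P_def)
  have hP: "h a \<in> P" "h a \<noteq> u" "h a \<noteq> v" if "a < s - 2" for a using h(2) that by auto
  define y0 where "y0 a = (if a = 0 then u else if a = 1 then v else h (a - 2))" for a
  define y where "y i a = (if i = 0 then y0 a else x (i - 1) (e a))" for i a
  have y0_cases: "y0 a = u \<or> y0 a = v \<or> y0 a \<in> P" if "a < s" for a
    using hP(1)[of "a - 2"] that by (auto simp: y0_def)
  have "x (r - 1) (e a) \<in> S" if "a < s" for a
    using x(1) eJ[OF that] r2 subsetD[OF US[of "r - 1"]] by simp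
  then have PS: "P \<subseteq> S" by (auto simp: P_def)
  have xW: "x i (e a) \<in> W" if "i < r - 1" "a < s" for i a
  proof -
    have "i < r" "i \<noteq> r - 1" using that by auto
    then show ?thesis using x(1) eJ[OF that(2)] by (auto simp: U_def)
  qed
  have adj0: "adj (y0 a) (x i (e b))" if "i < r - 1" "a < s" "b < s" for i a b
    using y0_cases[OF that(2)]
  proof (elim disjE)
    assume "y0 a \<in> P"
    then obtain a' where "a' < s" "y0 a = x (r - 1) (e a')" by (auto simp: P_def)
    then show ?thesis using x(3) eJ that by auto
  qed (use xW[OF that(1,3)] in \<open>auto simp: W_def nbrs_def\<close>)
  have "u \<noteq> v" using uv(3) adj_irrefl by auto
  have "K_plus_map r s S y"
    unfolding K_plus_map_def
  proof (intro conjI allI impI)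
    fix i a assume "i < r" "a < s"
    then show "y i a \<in> S"
      using y0_cases[of a] PS uv xW[of "i - 1" a] by (auto simp: y_def W_def nbrs_def)
  next
    fix i assume i: "i < r"
    show "inj_on (y i) {..<s}"
    proof (cases "i = 0")
      case True
      have "inj_on y0 {..<s}"
      proof (rule inj_onI)
        fix a b assume ab: "a \<in> {..<s}" "b \<in> {..<s}" "y0 a = y0 b"
        have lt: "c - 2 < s - 2" if "c < s" "0 < c" "c \<noteq> Suc 0" for c using that by auto
        have "a = b" if "h (a - 2) = h (b - 2)" "a \<ge> 2" "b \<ge> 2"
        proof -
          have "a - 2 < s - 2" "b - 2 < s - 2" using ab that by auto
          then have "a - 2 = b - 2" using inj_onD[OF h(1) that(1)] by simp
          then show ?thesis using that by simp
        qed
        then show "a = b" using ab hP(2,3)[of "a - 2"] hP(2,3)[of "b - 2"] \<open>u \<noteq> v\<close>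
          by (auto simp: y0_def lt split: if_splits)
      qed
      then show ?thesis using True by (simp add: y_def cong: inj_on_cong)
    next
      case False
      then have "inj_on (\<lambda>a. x (i - 1) (e a)) {..<s}"
        using inj[of "i - 1"] i by simp
      then show ?thesis using False by (simp add: y_def cong: inj_on_cong)
    qed
  next
    fix i j a b assume ij: "i < r" "j < r" "i \<noteq> j" "a < s" "b < s"
    consider "i = 0" | "j = 0" | "i \<noteq> 0" "j \<noteq> 0" by blast
    then show "adj (y i a) (y j b)"
    proof cases
      case 1
      then show ?thesis using adj0[of "j - 1" a b] ij by (auto simp: y_def)
    next
      case 2
      then show ?thesis using adj0[of "i - 1" b a] ij by (auto simp: y_def intro: adj_sym)
    next
      case 3
      then have "i - 1 < r" "j - 1 < r" "i - 1 \<noteq> j - 1" using ij by auto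
      then have "adj (x (i - 1) (e a)) (x (j - 1) (e b))"
        using x(3) eJ ij(4,5) by blast
      then show ?thesis using 3 by (simp add: y_def)
    qed
  next
    show "adj (y 0 0) (y 0 1)" using uv by (simp add: y_def y0_def)
  qed
  then show ?thesis by blast
qed

lemma colourable_or_K_plus_map:
  fixes r s T :: nat and \<eta> :: real
  assumes "finite S" "r \<ge> 2" "\<eta> = 1 / real r ^ 4"
    and "\<And>v. v \<in> S \<Longrightarrow> real (card (nbrs S v)) > (1 - 1 / real r - \<eta>) * real (card S)"
    and "s \<ge> 2" "real T * 2 ^ Suc T \<le> \<eta> * real (card S)" "real s \<le> (\<eta> / 2) ^ r * real T"
  shows "colourable r S \<or> (\<exists>y. K_plus_map r s S y)"
proof (cases "\<exists>y. (\<forall>i\<le>r. y i \<in> S) \<and> clique_map {..r} y")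
  case True
  then obtain y where "\<And>i. i \<le> r \<Longrightarrow> y i \<in> S" "clique_map {..r} y" by blast
  from rich_edge[OF assms(1-4) this] obtain u v where "u \<in> S" "v \<in> S" "adj u v"
    "real (card (nbrs S u \<inter> nbrs S v)) \<ge> ((real r - 2) * (1 / real r + \<eta>) + \<eta>) * real (card S)"
    by blast
  from K_plus_map_if_rich_edge[OF assms(1-4) this assms(5-7)] show ?thesis by blast
next
  case False
  then show ?thesis using colourable_if_clique_free[OF assms(1-4)] by blast
qed

section \<open>The Turan bound and its near-equality case\<close>

lemma sum_card_colour_classes:
  fixes r :: nat
  assumes "finite S" "f ` S \<subseteq> {..<r}"
  shows "(\<Sum>i<r. real (card {v \<in> S. f v = i})) = real (card S)"
  using sum.group[OF assms(1) finite_lessThan assms(2), where h = "\<lambda>_. 1 :: real"] by simp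

text \<open>For a proper colouring the first sum is twice the number of missing edges between
  classes, and the second measures their imbalance. Both are nonnegative, so the identity yields the
  Turan bound together with the structure near equality.\<close>

lemma colour_class_identity:
  fixes r :: nat
  assumes "finite S" "r > 0" "f ` S \<subseteq> {..<r}"
  defines "k \<equiv> \<lambda>i. real (card {v \<in> S. f v = i})"
  shows "(\<Sum>v\<in>S. real (card S) - k (f v) - real (card (nbrs S v))) + (\<Sum>i<r. (k i - real (card S) / real r)\<^sup>2)
    = (1 - 1 / real r) * (real (card S))\<^sup>2 - real (degree_sum S)"
proof -
  have k1: "(\<Sum>i<r. k i) = real (card S)"
    unfolding k_def by (rule sum_card_colour_classes[OF assms(1,3)])
  have "(\<Sum>i<r. \<Sum>v\<in>{v \<in> S. f v = i}. k (f v)) = (\<Sum>v\<in>S. k (f v))"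
    by (rule sum.group) (use assms in auto)
  moreover have "(\<Sum>v\<in>{v \<in> S. f v = i}. k (f v)) = (k i)\<^sup>2" for i
  proof -
    have "(\<Sum>v\<in>{v \<in> S. f v = i}. k (f v)) = (\<Sum>v\<in>{v \<in> S. f v = i}. k i)" by (rule sum.cong) auto
    then show ?thesis by (simp add: k_def power2_eq_square)
  qed
  ultimately have k2: "(\<Sum>v\<in>S. k (f v)) = (\<Sum>i<r. (k i)\<^sup>2)" by simp
  have "(\<Sum>i<r. (k i - real (card S) / real r)\<^sup>2)
    = (\<Sum>i<r. (k i)\<^sup>2 - 2 * real (card S) / real r * k i + (real (card S) / real r)\<^sup>2)"
    by (intro sum.cong refl) (simp add: power2_diff)
  also have "\<dots> = (\<Sum>i<r. (k i)\<^sup>2) - 2 * real (card S) / real r * (\<Sum>i<r. k i) + real r * (real (card S) / real r)\<^sup>2"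
    by (simp add: sum.distrib sum_subtractf sum_distrib_left)
  also have "\<dots> = (\<Sum>i<r. (k i)\<^sup>2) - (real (card S))\<^sup>2 / real r"
    using assms(2) unfolding k1 by (simp add: field_simps power2_eq_square)
  finally have "(\<Sum>i<r. (k i - real (card S) / real r)\<^sup>2) = (\<Sum>i<r. (k i)\<^sup>2) - (real (card S))\<^sup>2 / real r" .
  moreover have "(\<Sum>v\<in>S. real (card S) - k (f v) - real (card (nbrs S v)))
    = (real (card S))\<^sup>2 - (\<Sum>i<r. (k i)\<^sup>2) - real (degree_sum S)"
    by (simp add: sum_subtractf k2 degree_sum_def power2_eq_square)
  ultimately show ?thesis
    by (simp add: left_diff_distrib)
qed

lemma card_nbrs_le_colouring:
  assumes "finite S" "v \<in> S" "\<forall>u\<in>S. \<forall>v\<in>S. adj u v \<longrightarrow> f u \<noteq> f v"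
  shows "real (card (nbrs S v)) \<le> real (card S) - real (card {w \<in> S. f w = f v})"
proof -
  have "f v \<noteq> f w" if "w \<in> nbrs S v" for w
    using assms(2,3) that by (simp add: nbrs_def)
  then have "nbrs S v \<inter> {w \<in> S. f w = f v} = {}"
    by force
  then have "card (nbrs S v) + card {w \<in> S. f w = f v} = card (nbrs S v \<union> {w \<in> S. f w = f v})"
    using assms(1) by (simp add: card_Un_disjoint finite_nbrs)
  also have "\<dots> \<le> card S" using assms by (intro card_mono) (auto simp: nbrs_def)
  finally show ?thesis by simp
qed

lemma degree_sum_le_if_colourable:
  assumes "finite S" "r > 0" "colourable r S"
  shows "real (degree_sum S) \<le> (1 - 1 / real r) * (real (card S))\<^sup>2"
proof -
  obtain f where f: "f ` S \<subseteq> {..<r}" "\<forall>u\<in>S. \<forall>v\<in>S. adj u v \<longrightarrow> f u \<noteq> f v"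
    using assms(3) by (auto simp: colourable_def)
  have "0 \<le> (\<Sum>v\<in>S. real (card S) - real (card {w \<in> S. f w = f v}) - real (card (nbrs S v)))"
    using card_nbrs_le_colouring[OF assms(1) _ f(2)] by (intro sum_nonneg) auto
  moreover have "0 \<le> (\<Sum>i<r. (real (card {v \<in> S. f v = i}) - real (card S) / real r)\<^sup>2)"
    by (intro sum_nonneg) auto
  ultimately show ?thesis using colour_class_identity[OF assms(1,2) f(1)] by linarith
qed

text \<open>
  Less than \<open>1 / 4\<close> of an edge below the Turan bound, integrality forces equal colour classes
  and no missing edge between them.
\<close>
lemma near_extremal_colourable_degree:
  assumes "finite S" "r > 0" "colourable r S"
    and dense: "(1 - 1 / real r) * (real (card S))\<^sup>2 - 1 / 2 < real (degree_sum S)"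
    and x: "x \<in> S"
  shows "real (card (nbrs S x)) = (1 - 1 / real r) * real (card S)"
proof -
  define m where "m = real (card S)"
  obtain f where f: "f ` S \<subseteq> {..<r}" "\<forall>u\<in>S. \<forall>v\<in>S. adj u v \<longrightarrow> f u \<noteq> f v"
    using assms(3) by (auto simp: colourable_def)
  define k where "k i = card {v \<in> S. f v = i}" for i
  define g where "g v = m - real (k (f v)) - real (card (nbrs S v))" for v
  have g0: "g v \<ge> 0" if "v \<in> S" for v
    using card_nbrs_le_colouring[OF assms(1) that f(2)] by (simp add: g_def m_def k_def)
  have id: "(\<Sum>v\<in>S. g v) + (\<Sum>i<r. (real (k i) - m / real r)\<^sup>2) < 1 / 2"
    using colour_class_identity[OF assms(1,2) f(1)] dense unfolding g_def m_def k_def by linarith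
  have sq0: "0 \<le> (\<Sum>i<r. (real (k i) - m / real r)\<^sup>2)" by (intro sum_nonneg) auto
  have g00: "0 \<le> (\<Sum>v\<in>S. g v)" using g0 by (intro sum_nonneg)
  have eq: "k i = k j" if "i < r" "j < r" for i j
  proof (rule ccontr)
    assume ne: "k i \<noteq> k j"
    then have "i \<noteq> j" by auto
    \<comment> \<open>Unequal class sizes differ by at least 1, so their two squared deviations from
      \<open>m / r\<close> already sum to at least 1 / 2.\<close>
    have "\<bar>real (k i) - real (k j)\<bar> \<ge> 1" using ne by linarith
    then have "1 \<le> (real (k i) - real (k j))\<^sup>2" by (simp add: abs_le_square_iff[of 1, simplified])
    also have "\<dots> \<le> 2 * ((real (k i) - m / real r)\<^sup>2 + (real (k j) - m / real r)\<^sup>2)"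
    proof -
      have "(p - q)\<^sup>2 \<le> 2 * ((p - t)\<^sup>2 + (q - t)\<^sup>2)" for p q t :: real
        using zero_le_power2[of "(p - t) + (q - t)"] by (simp add: power2_eq_square algebra_simps)
      then show ?thesis .
    qed
    also have "(real (k i) - m / real r)\<^sup>2 + (real (k j) - m / real r)\<^sup>2 = (\<Sum>l\<in>{i, j}. (real (k l) - m / real r)\<^sup>2)"
      using \<open>i \<noteq> j\<close> by simp
    also have "\<dots> \<le> (\<Sum>i<r. (real (k i) - m / real r)\<^sup>2)"
      using that by (intro sum_mono2) auto
    finally show False using id g00 by linarith
  qed
  have fx: "f x < r" using f(1) x by auto
  have "(\<Sum>i<r. real (k i)) = m"
    unfolding m_def k_def by (rule sum_card_colour_classes[OF assms(1) f(1)])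
  moreover have "(\<Sum>i<r. real (k i)) = (\<Sum>i<r. real (k (f x)))" by (intro sum.cong refl arg_cong[where f = real] eq[OF _ fx]) simp
  ultimately have kx: "real (k (f x)) = m / real r" using assms(2) by (simp add: field_simps)
  have "g x \<le> (\<Sum>v\<in>S. g v)" using assms(1) x g0 by (intro member_le_sum) auto
  \<comment> \<open>\<open>g x\<close> is an integer, hence it vanishes.\<close>
  then have "g x < 1" "g x \<ge> 0" using id sq0 g0[OF x] by auto
  then have "card S = k (f x) + card (nbrs S x)" unfolding g_def m_def by linarith
  then have "m = real (k (f x)) + real (card (nbrs S x))" by (simp add: m_def)
  then show ?thesis using kx unfolding m_def[symmetric] by (simp add: left_diff_distrib)
qed

section \<open>The stability dichotomy\<close>

text \<open>The allowance for deletions is \<open>K\<close>, the integer part of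
  \<open>\<epsilon> n\<close>. Stopping before it is exhausted yields the set of large minimum
  degree; exhausting it lifts the density above the Turan bound. If \<open>K = 0\<close> the deficit
  of \<open>degree_sum V\<close> is below 1 / 2: either
  \<open>near_extremal_colourable_degree\<close> applies to \<open>V\<close> itself, or deleting one
  vertex of low degree exceeds the Turan bound.\<close>

lemma stability_dichotomy:
  fixes r s T :: nat and \<epsilon> \<eta> :: real
  assumes fin: "finite V" and r2: "r \<ge> 2" and \<eta>: "\<eta> = 1 / real r ^ 4" and \<epsilon>: "0 < \<epsilon>" "2 * \<epsilon> < \<eta>"
    and dense: "(1 - 1 / real r - \<epsilon>\<^sup>2 / 2) * (real (card V))\<^sup>2 \<le> real (degree_sum V)"
    and large: "2 * real r ^ 7 < real (card V)"
    and s: "s \<ge> 2" "real s \<le> (\<eta> / 2) ^ r * real T"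
    and T: "real T * 2 ^ Suc T * real r ^ 8 \<le> real (card V)"
  shows "(\<exists>y. K_plus_map r s V y) \<or>
    (\<exists>S\<subseteq>V. colourable r S \<and> (1 - \<epsilon>) * real (card V) \<le> real (card S)
      \<and> (\<forall>v\<in>S. (1 - 1 / real r - 2 * \<epsilon>) * real (card V) < real (card (nbrs S v))))"
proof (rule disjCI)
  assume no_small: "\<not> (\<exists>S\<subseteq>V. colourable r S \<and> (1 - \<epsilon>) * real (card V) \<le> real (card S)
      \<and> (\<forall>v\<in>S. (1 - 1 / real r - 2 * \<epsilon>) * real (card V) < real (card (nbrs S v))))"
  show "\<exists>y. K_plus_map r s V y"
  proof (rule ccontr)
    assume no_map: "\<not> (\<exists>y. K_plus_map r s V y)"
    define n where "n = real (card V)"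
    have r: "real r \<ge> 2" using r2 by simp
    have \<eta>0: "\<eta> > 0" using r by (simp add: \<eta>)
    have r1: "0 < 1 / real r" "1 / real r \<le> 1 / 2" using r by (auto simp: field_simps)
    have "(2::real) ^ 4 \<le> real r ^ 4" using r by (intro power_mono) auto
    then have \<eta>1: "\<eta> \<le> 1 / 16" using r by (simp add: \<eta> field_simps)
    have r47: "real r ^ 4 \<le> real r ^ 7" using r by (intro power_increasing) auto
    have n4: "2 * real r ^ 4 < n" using large r47 by (simp add: n_def)
    have n0: "n > 0" using n4 r by (smt (verit) zero_le_power)
    have \<eta>n: "\<eta> * n > 2" using n4 r by (simp add: \<eta> field_simps)
    \<comment> \<open>Of the factor \<open>r ^ 8\<close> in the hypothesis on \<open>T\<close>, one
      \<open>r ^ 4\<close> pays for passing from \<open>V\<close> to \<open>S\<close> and the other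
      is \<open>1 / \<eta>\<close>.\<close>
    have key: "colourable r S" if S: "S \<subseteq> V" "n \<le> real r ^ 4 * real (card S)"
      "\<And>v. v \<in> S \<Longrightarrow> real (card (nbrs S v)) > (1 - 1 / real r - \<eta>) * real (card S)" for S
    proof -
      have "real T * 2 ^ Suc T * real r ^ 8 \<le> real r ^ 4 * real (card S)"
        using T S(2) by (simp add: n_def)
      also have "real r ^ 8 = real r ^ 4 * real r ^ 4" by (simp flip: power_add)
      finally have "real r ^ 4 * (real T * 2 ^ Suc T * real r ^ 4) \<le> real r ^ 4 * real (card S)"
        by (simp add: mult_ac)
      then have "real T * 2 ^ Suc T * real r ^ 4 \<le> real (card S)"
        by (rule mult_left_le_imp_le) (use r in simp)
      then have "real T * 2 ^ Suc T \<le> \<eta> * real (card S)"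
        using r by (simp add: \<eta> field_simps)
      from colourable_or_K_plus_map[OF finite_subset[OF S(1) fin] r2 \<eta> S(3) s(1) this s(2)]
      have "colourable r S \<or> (\<exists>y. K_plus_map r s S y)" by simp
      moreover have "K_plus_map r s V y" if "K_plus_map r s S y" for y
        using that S(1) by (auto simp: K_plus_map_def)
      ultimately show ?thesis using no_map by blast
    qed
    \<comment> \<open>The subset supplied by \<open>dense_subset_min_degree\<close> has at least
      \<open>n / (2 r ^ 3) \<ge> n / r ^ 4\<close> vertices, so \<open>key\<close> colours it,
      although it exceeds the Turan bound.\<close>
    have no_dense: False
      if S: "S \<subseteq> V" "n \<le> 2 * real (card S)" "(1 - 1 / real r) * (real (card S))\<^sup>2 < real (degree_sum S)" for S
    proof -
      have finS: "finite S" using S(1) fin finite_subset by blast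
      have "real r ^ 7 < real (card S)" using large S(2) by (simp only: n_def)
      from dense_subset_min_degree[OF finS r2 \<eta> S(3) this] obtain S' where S':
        "S' \<subseteq> S" "real (card S) \<le> real r ^ 3 * real (card S')"
        "(1 - 1 / real r) * (real (card S'))\<^sup>2 < real (degree_sum S')"
        "\<And>v. v \<in> S' \<Longrightarrow> (1 - 1 / real r - \<eta>) * real (card S') < real (card (nbrs S' v))"
        by (metis (no_types, lifting))
      have "n \<le> 2 * (real r ^ 3 * real (card S'))" using S(2) S'(2) by linarith
      also have "\<dots> \<le> real r * (real r ^ 3 * real (card S'))" using r by (intro mult_right_mono) auto
      also have "\<dots> = real r ^ 4 * real (card S')" by (simp add: power4_eq_xxxx power3_eq_cube)
      finally have "colourable r S'" using key S S' by blast
      moreover have "finite S'" using S'(1) finS finite_subset by blast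
      ultimately show False using degree_sum_le_if_colourable[of S' r] S'(3) r2 by simp
    qed
    have large_enough: "n \<le> real r ^ 4 * real (card S)" if "n \<le> 2 * real (card S)" for S
    proof -
      have "2 * real (card S) \<le> real r ^ 4 * real (card S)"
        using \<open>2 ^ 4 \<le> real r ^ 4\<close> by (intro mult_right_mono) auto
      then show ?thesis using that by linarith
    qed
    define \<tau> where "\<tau> = (1 - 1 / real r - 2 * \<epsilon>) * n"
    define K where "K = nat \<lfloor>\<epsilon> * n\<rfloor>"
    have \<epsilon>n: "\<epsilon> * n \<ge> 0" using \<epsilon> n0 by simp
    have K: "real K \<le> \<epsilon> * n" "\<epsilon> * n < real K + 1"
      using \<epsilon>n by (auto simp: K_def) 
    have "\<epsilon> * n \<le> (1 / 2) * n" using \<epsilon>(2) \<eta>1 n0 by (intro mult_right_mono) auto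
    then have Kn: "2 * real K \<le> n" using K(1) by linarith
    then have KV: "K \<le> card V" by (simp add: n_def)
    \<comment> \<open>A minimal maximiser of \<open>\<Theta>\<close> over \<open>F\<close> stands for the result of deleting vertices of degree at most \<open>\<tau>\<close>.\<close>
    define F where "F = {S. S \<subseteq> V \<and> card V - K \<le> card S}"
    define \<Theta> where "\<Theta> S = real (degree_sum S) - 2 * \<tau> * real (card S)" for S
    have finF: "finite (\<Theta> ` F)" unfolding F_def using fin by auto
    have "V \<in> F" by (simp add: F_def)
    then obtain S0 where S0: "S0 \<in> F" "\<Theta> S0 = Max (\<Theta> ` F)"
      using Max_in[OF finF] by (metis empty_iff imageE image_is_empty)
    then obtain S where S: "S \<in> F" "\<Theta> S = Max (\<Theta> ` F)"
      and S_min: "\<And>S'. S' \<in> F \<Longrightarrow> \<Theta> S' = Max (\<Theta> ` F) \<Longrightarrow> card S \<le> card S'"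
      using ex_has_least_nat[of "\<lambda>S. S \<in> F \<and> \<Theta> S = Max (\<Theta> ` F)" S0 card] by blast
    have S_max: "\<Theta> S' \<le> \<Theta> S" if "S' \<in> F" for S'
      using Max_ge[OF finF] that S(2) by simp
    have SV: "S \<subseteq> V" "card V - K \<le> card S" using S(1) by (auto simp: F_def)
    have finS: "finite S" using SV(1) fin finite_subset by blast
    have SnK: "n - real K \<le> real (card S)" using SV(2) KV by (simp add: n_def of_nat_diff)
    have Sn: "n \<le> 2 * real (card S)" using SnK Kn by linarith
    have card_le: "real (card S) \<le> n" using SV(1) fin by (simp add: n_def card_mono)
    have pos: "0 \<le> 1 - 1 / real r - \<eta>" using r1 \<eta>1 by linarith
    consider "card V - K < card S" | "card S = card V - K" "K \<ge> 1" | "K = 0" "card S = card V"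
      using SV(2) by linarith
    then show False
    proof cases
      case 1
      have deg: "\<tau> < real (card (nbrs S v))" if v: "v \<in> S" for v
      proof -
        have cS: "card S = Suc (card (S - {v}))" using card.remove[OF finS v] .
        then have inF: "S - {v} \<in> F" using 1 SV by (auto simp: F_def)
        \<comment> \<open>Deleting \<open>v\<close> changes \<open>\<Theta>\<close> by twice the
          difference of \<open>\<tau>\<close> and the degree of \<open>v\<close>. Minimality of
          \<open>S\<close> among the maximisers excludes equality and makes the degree bound
          strict.\<close>
        have "\<Theta> (S - {v}) \<noteq> \<Theta> S" using S_min[OF inF] S(2) cS by auto
        then have "\<Theta> (S - {v}) < \<Theta> S" using S_max[OF inF] by simp
        then show ?thesis using degree_sum_delete[OF finS v] cS
          by (simp add: \<Theta>_def algebra_simps)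
      qed
      have "(1 - 1 / real r - \<eta>) * real (card S) \<le> (1 - 1 / real r - \<eta>) * n"
        using pos card_le by (rule mult_left_mono[rotated])
      also have "\<dots> \<le> \<tau>" unfolding \<tau>_def using \<epsilon>(2) n0 by (intro mult_right_mono) auto
      finally have "colourable r S"
        using key[OF SV(1) large_enough[OF Sn]] deg by (meson order_le_less_trans)
      moreover have "(1 - \<epsilon>) * n \<le> real (card S)" using SnK K(1) by (simp add: algebra_simps)
      ultimately show False using no_small SV(1) deg by (auto simp: n_def \<tau>_def)
    next
      case 2
      have cS: "real (card S) = n - real K" using 2 KV by (simp add: n_def of_nat_diff)
      define x where "x = \<epsilon> * n"
      have x: "real K \<le> x" "x < real K + 1" "real K \<ge> 1" using K 2 by (auto simp: x_def)
      have "\<Theta> V \<le> \<Theta> S" using S_max \<open>V \<in> F\<close> by blast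
      then have "real (degree_sum S) \<ge> real (degree_sum V) - 2 * \<tau> * real K"
        by (simp add: \<Theta>_def cS n_def[symmetric] algebra_simps)
      moreover have "real (degree_sum V) \<ge> (1 - 1 / real r) * n\<^sup>2 - x\<^sup>2 / 2"
        using dense by (simp add: n_def x_def algebra_simps power_mult_distrib)
      moreover have "\<tau> = (1 - 1 / real r) * n - 2 * x" by (simp add: \<tau>_def x_def algebra_simps)
      ultimately have low: "real (degree_sum S) \<ge> (1 - 1 / real r) * n\<^sup>2 - x\<^sup>2 / 2 - 2 * ((1 - 1 / real r) * n - 2 * x) * real K"
        by simp
      \<comment> \<open>The excess over the Turan bound for \<open>n - K\<close> vertices is at
        least \<open>4 x K - x\<^sup>2 / 2 - (1 - 1 / r) K\<^sup>2\<close>. Both subtracted terms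
        are at most \<open>x K\<close>, the first because
        \<open>x < K + 1 \<le> 2 K\<close>.\<close>
      have "(1 - 1 / real r) * (real K)\<^sup>2 \<le> 1 * (real K)\<^sup>2" using r1 by (intro mult_right_mono) auto
      also have "\<dots> \<le> x * real K" using x by (simp add: power2_eq_square mult_right_mono)
      finally have k2: "(1 - 1 / real r) * (real K)\<^sup>2 \<le> x * real K" .
      have "x * x \<le> x * (2 * real K)" using x by (intro mult_left_mono) auto
      then have x2: "x\<^sup>2 / 2 \<le> x * real K" by (simp add: power2_eq_square)
      have xK: "x * real K > 0" using x by (intro mult_pos_pos) auto
      have "(1 - 1 / real r) * (n - real K)\<^sup>2
        = (1 - 1 / real r) * n\<^sup>2 - 2 * ((1 - 1 / real r) * n) * real K + (1 - 1 / real r) * (real K)\<^sup>2"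
        by (simp add: power2_diff algebra_simps)
      moreover have "2 * (A - 2 * x) * real K = 2 * A * real K - 4 * (x * real K)" for A
        by (simp add: algebra_simps)
      ultimately have "(1 - 1 / real r) * (n - real K)\<^sup>2 < real (degree_sum S)"
        using low k2 x2 xK by (smt (verit))
      then show False using no_dense[OF SV(1) Sn] by (simp add: cS)
    next
      case 3
      have "\<epsilon> * n < 1" using K(2) 3 by simp
      then have "(\<epsilon> * n)\<^sup>2 < 1" using \<epsilon>n by (simp add: abs_square_less_1)
      then have dV: "(1 - 1 / real r) * n\<^sup>2 - 1 / 2 < real (degree_sum V)"
        using dense by (simp add: n_def algebra_simps power_mult_distrib)
      show False
      proof (cases "\<forall>v\<in>V. (1 - 1 / real r - \<eta>) * n < real (card (nbrs V v))")
        case True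
        have col: "colourable r V"
          using True by (intro key large_enough) (auto simp: n_def)
        have "\<tau> < real (card (nbrs V v))" if "v \<in> V" for v
        proof -
          have "real (card (nbrs V v)) = (1 - 1 / real r) * n"
            using near_extremal_colourable_degree[OF fin _ col _ that] dV r2 by (simp add: n_def)
          moreover have "\<epsilon> * n > 0" using \<epsilon> n0 by simp
          ultimately show ?thesis by (simp add: \<tau>_def algebra_simps)
        qed
        moreover have "(1 - \<epsilon>) * n \<le> real (card V)" using \<epsilon>n by (simp add: n_def algebra_simps)
        ultimately show False using no_small col by (auto simp: n_def \<tau>_def)
      next
        case False
        then obtain v where v: "v \<in> V" "real (card (nbrs V v)) \<le> (1 - 1 / real r - \<eta>) * n" by force
        have cV: "real (card (V - {v})) = n - 1" using card.remove[OF fin v(1)] by (simp add: n_def)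
        \<comment> \<open>Against the Turan bound this deletion gains \<open>2 \<eta> n > 4\<close>,
          which outweighs the deficit 1 / 2 and the constant \<open>1 - 1 / r\<close> from expanding
          \<open>(n - 1)\<^sup>2\<close>.\<close>
        have "real (degree_sum (V - {v})) \<ge> real (degree_sum V) - 2 * ((1 - 1 / real r) * n - \<eta> * n)"
          using degree_sum_delete[OF fin v(1)] v(2) by (simp add: left_diff_distrib)
        moreover have "(1 - 1 / real r) * (n - 1)\<^sup>2 = (1 - 1 / real r) * n\<^sup>2 - 2 * ((1 - 1 / real r) * n) + (1 - 1 / real r)"
          by (simp add: power2_diff algebra_simps)
        moreover have "z < d" if "b - 2 * (q - h) \<le> d" "z = p - 2 * q + t" "p - 1 / 2 < b" "2 < h" "t < 1"
          for b q h d z p t :: real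
          using that by simp
        ultimately have "(1 - 1 / real r) * (n - 1)\<^sup>2 < real (degree_sum (V - {v}))"
          using dV \<eta>n r1(1) by (smt (verit))
        moreover have "n \<le> 2 * (n - 1)"
        proof -
          have "\<eta> * n \<le> 1 * n" using \<eta>1 n0 by (intro mult_right_mono) auto
          then show ?thesis using \<eta>n by simp
        qed
        ultimately show False using no_dense[of "V - {v}"] by (simp add: cV Diff_subset)
      qed
    qed
  qed
qed

end

section \<open>From adjacency relations back to graphs\<close>

abbreviation adjacent :: "'a graph \<Rightarrow> 'a \<Rightarrow> 'a \<Rightarrow> bool" where
  "adjacent G u v \<equiv> {u, v} \<in> edges G"

lemma symmetric_irreflexive_adjacent: "simple_graph G \<Longrightarrow> symmetric_irreflexive (adjacent G)"
  by unfold_locales (auto simp: insert_commute simple_graph_def)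

lemma vertex_degree_induced:
  assumes "simple_graph G" "v \<in> S"
  shows "vertex_degree \<lparr>verts = S, edges = {e \<in> edges G. e \<subseteq> S}\<rparr> v
    = card (symmetric_irreflexive.nbrs (adjacent G) S v)"
proof -
  interpret symmetric_irreflexive "adjacent G"
    by (rule symmetric_irreflexive_adjacent[OF assms(1)])
  have "{e \<in> {e \<in> edges G. e \<subseteq> S}. v \<in> e} = (\<lambda>w. {v, w}) ` nbrs S v"
  proof
    show "{e \<in> {e \<in> edges G. e \<subseteq> S}. v \<in> e} \<subseteq> (\<lambda>w. {v, w}) ` nbrs S v"
    proof
      fix e assume e: "e \<in> {e \<in> {e \<in> edges G. e \<subseteq> S}. v \<in> e}"
      then have "card e = 2" using assms(1) by (auto simp: simple_graph_def)
      then obtain w where "e = {v, w}" using e by (auto simp: card_2_iff)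
      then show "e \<in> (\<lambda>w. {v, w}) ` nbrs S v" using e by (auto simp: nbrs_def)
    qed
  qed (use assms(2) in \<open>auto simp: nbrs_def\<close>)
  moreover have "inj_on (\<lambda>w. {v, w}) (nbrs S v)"
    by (rule inj_onI) (auto simp: doubleton_eq_iff)
  ultimately show ?thesis by (simp add: vertex_degree_def card_image)
qed

lemma degree_sum_verts:
  assumes "simple_graph G"
  shows "symmetric_irreflexive.degree_sum (adjacent G) (verts G) = 2 * graph_size G"
proof -
  interpret symmetric_irreflexive "adjacent G"
    by (rule symmetric_irreflexive_adjacent[OF assms])
  have G: "finite (verts G)" "\<And>e. e \<in> edges G \<Longrightarrow> e \<subseteq> verts G" "\<And>e. e \<in> edges G \<Longrightarrow> card e = 2"
    using assms by (auto simp: simple_graph_def)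
  have "edges G \<subseteq> Pow (verts G)" using G(2) by blast
  then have finE: "finite (edges G)" using G(1) by (simp add: finite_subset)
  have "{e \<in> edges G. e \<subseteq> verts G} = edges G" using G(2) by blast
  then have "card (nbrs (verts G) v) = card {e \<in> edges G. v \<in> e}" if "v \<in> verts G" for v
    using vertex_degree_induced[OF assms that] by (simp add: vertex_degree_def)
  then have "degree_sum (verts G) = (\<Sum>v\<in>verts G. card {e \<in> edges G. v \<in> e})"
    by (simp add: degree_sum_def)
  also have "\<dots> = (\<Sum>v\<in>verts G. \<Sum>e\<in>edges G. if v \<in> e then 1 else 0)"
    using finE by (intro sum.cong refl) (simp add: sum.If_cases Int_def)
  also have "\<dots> = (\<Sum>e\<in>edges G. \<Sum>v\<in>verts G. if v \<in> e then 1 else 0)"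
    by (rule sum.swap)
  also have "\<dots> = (\<Sum>e\<in>edges G. 2)"
    using G by (intro sum.cong refl) (simp add: sum.If_cases Int_absorb1)
  finally show ?thesis by (simp add: graph_size_def)
qed

lemma isomorphic_image_graph:
  assumes "inj_on g (verts K)" "\<And>e. e \<in> edges K \<Longrightarrow> e \<subseteq> verts K"
  shows "isomorphic \<lparr>verts = g ` verts K, edges = (`) g ` edges K\<rparr> K"
proof -
  define f where "f = inv_into (verts K) g"
  have fg: "f (g a) = a" if "a \<in> verts K" for a
    using that assms(1) by (simp add: f_def)
  have "bij_betw f (g ` verts K) (verts K)"
    unfolding f_def using assms(1) by (simp add: bij_betw_inv_into inj_on_imp_bij_betw)
  moreover have "{g a, g b} \<in> (`) g ` edges K \<longleftrightarrow> {a, b} \<in> edges K"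
    if "a \<in> verts K" "b \<in> verts K" for a b
  proof
    assume "{g a, g b} \<in> (`) g ` edges K"
    then obtain e where e: "e \<in> edges K" "g ` {a, b} = g ` e" by auto
    then have "{a, b} = e"
      using inj_on_image_eq_iff[OF assms(1), of "{a, b}" e] assms(2)[OF e(1)] that by auto
    then show "{a, b} \<in> edges K" using e by simp
  next
    assume "{a, b} \<in> edges K"
    then have "g ` {a, b} \<in> (`) g ` edges K" by (rule imageI)
    then show "{g a, g b} \<in> (`) g ` edges K" by simp
  qed
  ultimately show ?thesis
    unfolding isomorphic_def by (intro exI[of _ f]) (auto simp: fg)
qed

lemma subgraph_if_K_plus_map:
  assumes G: "simple_graph G" and rs: "r \<ge> 2" "s \<ge> 2"
    and y: "symmetric_irreflexive.K_plus_map (adjacent G) r s (verts G) y"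
  shows "\<exists>H. subgraph H G \<and> isomorphic H (K_plus (replicate r s))"
proof -
  interpret symmetric_irreflexive "adjacent G"
    by (rule symmetric_irreflexive_adjacent[OF G])
  define K where "K = K_plus (replicate r s)"
  define g where "g = (\<lambda>(i, a). y i a)"
  define H where "H = \<lparr>verts = g ` verts K, edges = (`) g ` edges K\<rparr>"
  have yV: "y i a \<in> verts G" if "i < r" "a < s" for i a
    using y that by (simp add: K_plus_map_def)
  have yinj: "inj_on (y i) {..<s}" if "i < r" for i
    using y that by (simp add: K_plus_map_def)
  have yadj: "adjacent G (y i a) (y j b)" if "i < r" "j < r" "i \<noteq> j" "a < s" "b < s" for i j a b
    using y that by (simp add: K_plus_map_def)
  have y01: "adjacent G (y 0 0) (y 0 1)" using y by (simp add: K_plus_map_def)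
  have vK: "verts K = {(i, a). i < r \<and> a < s}"
    by (auto simp: K_def K_plus_def complete_multipartite_def)
  have eK: "edges K = insert {(0, 0), (0, 1)}
      {{(i, a), (j, b)} | i a j b. i < r \<and> a < s \<and> j < r \<and> b < s \<and> i \<noteq> j}"
    unfolding K_def K_plus_def complete_multipartite_def
    by (simp cong: conj_cong)
  have simpleK: "simple_graph K"
    unfolding K_def using rs by (intro simple_graph_K_plus) auto
  have inj: "inj_on g (verts K)"
  proof (rule inj_onI)
    fix p q assume pq: "p \<in> verts K" "q \<in> verts K" "g p = g q"
    obtain i a j b where ij: "p = (i, a)" "q = (j, b)" by (cases p, cases q)
    then have *: "i < r" "a < s" "j < r" "b < s" "y i a = y j b" using pq by (auto simp: vK g_def)
    then have "i = j" using yadj[of i j a b] adj_irrefl[of "y i a"] by auto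
    then show "p = q" using inj_onD[OF yinj[OF *(1)], of a b] * ij by simp
  qed
  have "isomorphic H K"
    unfolding H_def using simpleK by (intro isomorphic_image_graph[OF inj]) (auto simp: simple_graph_def)
  moreover have "subgraph H G"
  proof -
    have vH: "verts H \<subseteq> verts G" using yV by (auto simp: H_def vK g_def)
    have eH: "edges H \<subseteq> edges G"
      using yadj y01 by (auto simp: H_def eK g_def)
    have "e \<subseteq> verts H" if "e \<in> edges H" for e
      using that simpleK by (auto simp: H_def simple_graph_def)
    then have "simple_graph H"
      using G eH vH finite_subset[OF vH] by (auto simp: simple_graph_def)
    then show ?thesis using vH eH by (simp add: subgraph_def)
  qed
  ultimately show ?thesis unfolding K_def by blast
qed

section \<open>Estimates for the part size\<close>

text \<open>\<open>T\<close> is the initial number of rows: each of the \<open>r\<close> parts costs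
  a factor \<open>\<eta> / 2 \<ge> 1 / r ^ 5\<close>, and \<open>s\<close> rows have to survive. The
  exponent in \<open>c\<close> is large enough for \<open>2 T \<le> ln n / 2\<close>, so
  \<open>T * 2 ^ T\<close> is at most the square root of \<open>n\<close>, which also bounds
  \<open>2 r ^ 8\<close> because \<open>1 / c \<le> ln n / 2\<close>.\<close>

lemma embedding_size_bounds:
  fixes r n :: nat and c :: real
  assumes r2: "r \<ge> 2" and c: "c = (real r powi (- int ((r + 7) * (r + 1)))) / 2"
    and n: "real n \<ge> exp (2 / c)"
  defines "s \<equiv> nat \<lfloor>c * ln (real n)\<rfloor>"
  defines "T \<equiv> s * r ^ (5 * r)"
  shows "s \<ge> 2" "real s \<le> (1 / real r ^ 4 / 2) ^ r * real T"
    "real T * 2 ^ Suc T * real r ^ 8 \<le> real n" "2 * real r ^ 7 < real n"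
proof -
  define p where "p = (r + 7) * (r + 1)"
  have r: "real r \<ge> 2" using r2 by simp
  have "c = real r powi (- int p) / 2" unfolding c p_def ..
  then have c': "c = 1 / (2 * real r ^ p)" by (simp add: power_int_minus inverse_eq_divide)
  have c0: "c > 0" using r by (simp add: c')
  have n0: "real n > 0" using n exp_gt_zero[of "2 / c"] by linarith
  define L where "L = ln (real n)"
  have L: "2 / c \<le> L" using n n0 by (simp add: L_def ln_ge_iff)
  have cL: "c * L \<ge> 2" using L c0 by (simp add: field_simps)
  then have s_le: "real s \<le> c * L" unfolding s_def L_def by linarith
  show s2: "s \<ge> 2" using cL unfolding s_def L_def by linarith
  have "real r ^ 4 * 2 \<le> real r ^ 4 * real r" using r by (intro mult_left_mono) auto
  then have "1 / real r ^ 5 \<le> 1 / real r ^ 4 / 2"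
    using r by (simp add: frac_le eval_nat_numeral)
  then have "(1 / real r ^ 5) ^ r \<le> (1 / real r ^ 4 / 2) ^ r" by (intro power_mono) auto
  then have "(1 / real r ^ 5) ^ r * real T \<le> (1 / real r ^ 4 / 2) ^ r * real T" by (intro mult_right_mono) auto
  moreover have "(1 / real r ^ 5) ^ r * real T = real s"
    using r by (simp add: T_def power_one_over power_mult)
  ultimately show "real s \<le> (1 / real r ^ 4 / 2) ^ r * real T" by simp
  \<comment> \<open>The exponent \<open>p\<close> is at least \<open>5 r + 1\<close>; the additional
    factor \<open>r\<close> absorbs a 2.\<close>
  have "real r ^ Suc (5 * r) \<le> real r ^ p"
    using r by (intro power_increasing) (auto simp: p_def algebra_simps)
  moreover have "2 * real r ^ (5 * r) \<le> real r ^ Suc (5 * r)"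
    using r by simp
  ultimately have "2 * real r ^ (5 * r) \<le> real r ^ p" by linarith
  then have "c * real r ^ (5 * r) \<le> 1 / 4" using r by (simp add: c' field_simps)
  then have "c * real r ^ (5 * r) * L \<le> 1 / 4 * L"
    using L c0 by (intro mult_right_mono) (auto intro: order_trans[rotated])
  moreover have "real T \<le> c * L * real r ^ (5 * r)"
    unfolding T_def using s_le by (simp add: mult_right_mono)
  ultimately have TL: "2 * real T \<le> L / 2" by (simp add: mult_ac)
  have "2 \<le> exp (1::real)" using exp_ge_add_one_self[of 1] by simp
  then have e2: "2 ^ T \<le> exp (real T)"
    using power_mono[of 2 "exp (1::real)" T] by (simp add: exp_of_nat_mult[symmetric] flip: exp_of_nat_mult)
  have "real T \<le> exp (real T)" using exp_ge_add_one_self[of "real T"] by linarith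
  then have "real T * 2 ^ T \<le> exp (real T) * exp (real T)"
    using e2 by (intro mult_mono) auto
  also have "\<dots> = exp (2 * real T)" by (simp flip: exp_add)
  also have "\<dots> \<le> exp (L / 2)" using TL by simp
  finally have T2: "real T * 2 ^ T \<le> exp (L / 2)" .
  have "2 * real r ^ p = 1 / c" by (simp add: c')
  also have "\<dots> \<le> L / 2" using L by simp
  also have "\<dots> \<le> exp (L / 2)" using exp_ge_add_one_self[of "L / 2"] by linarith
  finally have rp: "2 * real r ^ p \<le> exp (L / 2)" .
  have r8: "real r ^ 8 \<le> real r ^ p"
    using r2 by (intro power_increasing) (auto simp: p_def algebra_simps)
  have expL: "exp (L / 2) * exp (L / 2) = real n" using n0 by (simp add: L_def flip: exp_add)
  have "real T * 2 ^ Suc T * real r ^ 8 = (real T * 2 ^ T) * (2 * real r ^ 8)" by simp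
  also have "\<dots> \<le> exp (L / 2) * exp (L / 2)"
    using T2 rp r8 by (intro mult_mono) auto
  finally show "real T * 2 ^ Suc T * real r ^ 8 \<le> real n" using expL by simp
  have "2 * real r ^ 7 < 2 * real r ^ 8" using r by (simp add: power_strict_increasing)
  also have "\<dots> \<le> exp (L / 2)" using rp r8 by linarith
  also have "\<dots> = exp (L / 2) * 1" by simp
  also have "\<dots> \<le> exp (L / 2) * exp (L / 2)"
    using L c0 by (intro mult_left_mono) (auto intro: order_trans[rotated])
  finally show "2 * real r ^ 7 < real n" using expL by simp
qed

theorem theorem4:
  fixes r n :: nat and c \<alpha> :: real and G :: "'a graph"
  assumes "r \<ge> 2"
    and "c = (real r powi (- int ((r + 7) * (r + 1)))) / 2"
    and "0 < \<alpha>" and "\<alpha> < (real r powi (- 8)) / 8"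
    and "real n \<ge> exp (2 / c)"
    and "simple_graph G"
    and "graph_order G = n"
    and "int (graph_size G) = \<lceil>(1 - 1 / real r - \<alpha>) * (real n)\<^sup>2 / 2\<rceil>"
  shows "(\<exists>H. subgraph H G \<and> isomorphic H (K_plus (replicate r (nat \<lfloor>c * ln (real n)\<rfloor>))))
       \<or> (\<exists>G0. induced_subgraph G0 G \<and> partite r G0
            \<and> real (graph_order G0) \<ge> (1 - sqrt (2 * \<alpha>)) * real n
            \<and> real (min_degree G0) > (1 - 1 / real r - 2 * sqrt (2 * \<alpha>)) * real n)"
proof -
  interpret symmetric_irreflexive "adjacent G"
    by (rule symmetric_irreflexive_adjacent[OF assms(6)])
  define s where "s = nat \<lfloor>c * ln (real n)\<rfloor>"
  define \<epsilon> where "\<epsilon> = sqrt (2 * \<alpha>)"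
  note size = embedding_size_bounds[OF assms(1,2,5), folded s_def]
  have r: "real r \<ge> 2" using assms(1) by simp
  have fin: "finite (verts G)" using assms(6) by (simp add: simple_graph_def)
  have cV: "card (verts G) = n" using assms(7) by (simp add: graph_order_def)
  have \<epsilon>0: "0 < \<epsilon>" using assms(3) by (simp add: \<epsilon>_def)
  have \<epsilon>2: "\<epsilon>\<^sup>2 = 2 * \<alpha>" using assms(3) by (simp add: \<epsilon>_def)
  \<comment> \<open>Since \<open>(2 \<epsilon>)\<^sup>2 = 8 \<alpha>\<close>, the bound on
    \<open>\<alpha>\<close> says precisely that \<open>2 \<epsilon> < \<eta>\<close>.\<close>
  have "real r powi (- 8) = (1 / real r ^ 4)\<^sup>2"
    by (simp add: power_int_minus power_one_over inverse_eq_divide flip: power_mult)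
  then have "(2 * \<epsilon>)\<^sup>2 < (1 / real r ^ 4)\<^sup>2"
    using assms(4) by (simp add: power_mult_distrib \<epsilon>2)
  then have \<epsilon>r: "2 * \<epsilon> < 1 / real r ^ 4" by (rule power_less_imp_less_base) simp
  have "(1 - 1 / real r - \<alpha>) * (real n)\<^sup>2 / 2 \<le> real (graph_size G)"
    using assms(8) by (metis le_of_int_ceiling of_int_of_nat_eq)
  then have dense: "(1 - 1 / real r - \<epsilon>\<^sup>2 / 2) * (real (card (verts G)))\<^sup>2 \<le> real (degree_sum (verts G))"
    by (simp add: \<epsilon>2 cV degree_sum_verts[OF assms(6)])
  have \<epsilon>1: "\<epsilon> < 1"
  proof -
    have "1 / real r ^ 4 \<le> 1" using r by (simp add: one_le_power)
    then show ?thesis using \<epsilon>r \<epsilon>0 by linarith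
  qed
  have n0: "real n > 0" using size(4) r by (smt (verit) zero_le_power)
  from stability_dichotomy[OF fin assms(1) refl \<epsilon>0 \<epsilon>r dense _ size(1,2), unfolded cV, OF size(4,3)]
  show ?thesis
  proof (elim disjE exE conjE)
    fix y assume "K_plus_map r s (verts G) y"
    from subgraph_if_K_plus_map[OF assms(6,1) size(1) this] show ?thesis
      by (simp add: s_def)
  next
    fix S assume S: "S \<subseteq> verts G" "colourable r S" "(1 - \<epsilon>) * real n \<le> real (card S)"
      "\<forall>v\<in>S. (1 - 1 / real r - 2 * \<epsilon>) * real n < real (card (nbrs S v))"
    define G0 where "G0 = \<lparr>verts = S, edges = {e \<in> edges G. e \<subseteq> S}\<rparr>"
    \<comment> \<open>\<open>min_degree\<close> is a \<open>Min\<close> over the vertices and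
      carries meaning only for nonempty \<open>S\<close>; here \<open>\<epsilon> < 1\<close>
      provides this.\<close>
    have "0 < (1 - \<epsilon>) * real n" using \<epsilon>1 n0 by simp
    then have ne: "S \<noteq> {}" using S(3) by auto
    have finS: "finite S" using S(1) fin finite_subset by blast
    have "induced_subgraph G0 G" using S(1) by (simp add: induced_subgraph_def G0_def)
    moreover have "partite r G0"
      using S(2) unfolding colourable_def partite_def G0_def by auto
    moreover have "(1 - 1 / real r - 2 * \<epsilon>) * real n < real (min_degree G0)"
    proof -
      have "min_degree G0 \<in> vertex_degree G0 ` S"
        unfolding min_degree_def using ne finS by (simp add: G0_def)
      then obtain v where "v \<in> S" "min_degree G0 = vertex_degree G0 v" by blast
      then show ?thesis using S(4) vertex_degree_induced[OF assms(6)] by (simp add: G0_def)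
    qed
    ultimately show ?thesis using S(3) unfolding \<epsilon>_def
      by (intro disjI2 exI[of _ G0]) (simp add: graph_order_def G0_def)
  qed
qed

end
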